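(* Let $b$ be a prime, let $m,s,d\in\mathbb{N}$ with $d>1$, let $\alpha>1$ be an integer, let $\boldsymbol{\gamma}=(\gamma_v)_{v\subseteq\{1:s\}}$ be a set of weights, let $p\in\mathbb{F}_b[x]$ with $\deg(p)=m$ and $\boldsymbol{q}\in(\mathbb{F}_b[x])^{ds}$. Let $\mathcal{D}_d(P_{b^m,ds}(\boldsymbol{q},p))$ be the interlaced polynomial lattice point set of order $d$ and let $D^\perp_{\boldsymbol{q},p}$ be the dual polynomial lattice of $P_{b^m,ds}(\boldsymbol{q},p)$. For $d\le\alpha$, the worst-case error for numerical integration in $\mathcal{W}_{s,\alpha,\boldsymbol{\gamma}}$ using $\mathcal{D}_d(P_{b^m,ds}(\boldsymbol{q},p))$ is bounded as $$e(\mathcal{D}_d(P_{b^m,ds}(\boldsymbol{q},p)),\mathcal{W}_{s,\alpha,\boldsymbol{\gamma}})\le\sum_{\emptyset\ne u\subseteq\{1:ds\}}\gamma_{w(u)}\sum_{\substack{\boldsymbol{k}_u\in\mathbb{N}^{|u|}\\(\boldsymbol{k}_u,\boldsymbol{0})\in D^\perp_{\boldsymbol{q},p}}}\tilde r_{d,u,(2)}(\boldsymbol{k}_u).$$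
   Context: $\mathbb{N}$ is the set of positive integers, $\mathbb{N}_0=\mathbb{N}\cup\{0\}$, $\{a:c\}=\{a,a+1,\ldots,c\}$; $\mathbb{F}_b$ is the field with $b$ elements, identified with $\{0,1,\ldots,b-1\}$. All $b$-adic expansions of reals in $[0,1)$ are the unique ones with infinitely many digits different from $b-1$. A non-negative integer $k=\kappa_0+\cdots+\kappa_{a-1}b^{a-1}$ is identified with $k(x)=\kappa_0+\cdots+\kappa_{a-1}x^{a-1}\in\mathbb{F}_b[x]$. Polynomial lattice: $v_m(\sum_{l=w}^\infty t_lx^{-l})=\sum_{l=\max(1,w)}^m t_lb^{-l}$ for formal Laurent series over $\mathbb{F}_b$. $P_{b^m,ds}(\boldsymbol{q},p)$ consists of $\boldsymbol{z}_n=(z_{n,1},\ldots,z_{n,ds})$, $z_{n,j}=v_m(n(x)q_j(x)/p(x))$, $0\le n<b^m$. Interlacing: for $y_r=\sum_{a\ge1}y_{r,a}b^{-a}\in[0,1)$, $\mathcal{D}_d(y_1,\ldots,y_d)=\sum_{a=1}^\infty\sum_{r=1}^dy_{r,a}b^{-r-(a-1)d}$, applied to vectors in $[0,1)^{ds}$ on each of the $s$ consecutive blocks of $d$ components. $\mathcal{D}_d(P_{b^m,ds}(\boldsymbol{q},p))$ consists of the points $\mathcal{D}_d(\boldsymbol{z}_n)\in[0,1)^s$, $0\le n<b^m$. Dual lattice: $\mathrm{tr}_m(k)=\kappa_0+\kappa_1x+\cdots+\kappa_{m-1}x^{m-1}$ for $k$ with $b$-adic digits $\kappa_i$; $D^\perp_{\boldsymbol{q},p}=\{\boldsymbol{k}\in\mathbb{N}_0^{ds}:\sum_{j=1}^{ds}\mathrm{tr}_m(k_j)q_j\equiv0\pmod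 p\}$. $(\boldsymbol{k}_u,\boldsymbol{0})\in\mathbb{N}_0^{ds}$ has components $0$ outside $u$. For $u\subseteq\{1:ds\}$, $w(u)$ is the set of $1\le j\le s$ with $u\cap\{(j-1)d+1:jd\}\ne\emptyset$. Walsh functions: with $\omega_b=e^{2\pi\mathrm{i}/b}$, $\mathrm{wal}_k(x)=\omega_b^{x_1\kappa_0+\cdots+x_a\kappa_{a-1}}$ for $k=\kappa_0+\cdots+\kappa_{a-1}b^{a-1}$, $x=\sum_i x_ib^{-i}$; $\mathrm{wal}_{\boldsymbol{k}}(\boldsymbol{x})=\prod_j\mathrm{wal}_{k_j}(x_j)$. Walsh coefficients of $f\in L_2([0,1)^s)$: $\hat f(\boldsymbol{l})=\int_{[0,1)^s}f(\boldsymbol{x})\overline{\mathrm{wal}_{\boldsymbol{l}}(\boldsymbol{x})}\,\mathrm{d}\boldsymbol{x}$. $\mu_\alpha$, $r_\alpha$, $\tilde r_{d,u,(2)}$: for an integer $\alpha\ge1$ and $k=\kappa_1b^{a_1-1}+\cdots+\kappa_\nu b^{a_\nu-1}\in\mathbb{N}$ with $\nu\ge1$, $1\le a_\nu<\cdots<a_1$ and $\kappa_i\in\{1,\ldots,b-1\}$, $\mu_\alpha(k)=a_1+\cdots+a_{\min(\nu,\alpha)}$ (so $\mu_1(k)=a_1$); $\mu_\alpha(0)=0$; $r_\alpha(k)=b^{-\mu_\alpha(k)}$; for vectors, $r_\alpha$ is the product over components. Further, for $1\le j\le ds$, $\tilde r_{d,j,(2)}(0)=1$, $\tilde r_{d,j,(2)}(k)=b^{-d\mu_1(k)-j+d\lceil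 j/d\rceil}$ for $k\ge1$, and $\tilde r_{d,u,(2)}(\boldsymbol{k}_u)=\prod_{j\in u}\tilde r_{d,j,(2)}(k_j)$. Weighted Walsh space: $\mathcal{W}_{s,\alpha,\boldsymbol{\gamma}}$ is the function space consisting of functions $f:[0,1)^s\to\mathbb{R}$ for which the norm $$\|f\|_{\mathcal{W}_{s,\alpha,\boldsymbol{\gamma}}}=\max_{v\subseteq\{1:s\},\,\gamma_v\ne0}\gamma_v^{-1}\sup_{\boldsymbol{l}_v\in\mathbb{N}^{|v|}}\frac{|\hat f(\boldsymbol{l}_v,\boldsymbol{0})|}{r_\alpha(\boldsymbol{l}_v)}$$ is finite, where $(\boldsymbol{l}_v,\boldsymbol{0})\in\mathbb{N}_0^s$ has components $0$ outside $v$. For functions in this space the Walsh series $\sum_{\boldsymbol{l}\in\mathbb{N}_0^s}\hat f(\boldsymbol{l})\mathrm{wal}_{\boldsymbol{l}}(\boldsymbol{x})$ is taken to converge to $f$ pointwise absolutely. Worst-case error: for $P=\{\boldsymbol{x}_0,\ldots,\boldsymbol{x}_{N-1}\}$, $e(P,\mathcal{W}_{s,\alpha,\boldsymbol{\gamma}})=\sup\left|\frac1N\sum_{n=0}^{N-1}f(\boldsymbol{x}_n)-\int_{[0,1)^s}f(\boldsymbol{x})\,\mathrm{d}\boldsymbol{x}\right|$ over $f\in\mathcal{W}_{s,\alpha,\boldsymbol{\gamma}}$ with $\|f\|_{\mathcal{W}_{s,\alpha,\boldsymbol{\gamma}}}\le1$.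
   Formalization: Functions in the weighted Walsh space are additionally required to have vanishing Walsh coefficients supported exactly on any nonempty v with weight γ_v = 0; without this the norm ignores those components and the worst-case error is infinite while the bound is finite. *)

theory Defs
  imports
    "HOL-Analysis.Analysis"
    "HOL-Computational_Algebra.Computational_Algebra"
    "Berlekamp_Zassenhaus.Finite_Field"
begin

text \<open>
  The prime field with \<open>b\<close> elements is \<open>'p mod_ring\<close> for \<open>'p :: prime_card\<close> and
  \<open>b = CARD('p)\<close>; its identification with \<open>{0..b-1}\<close> is \<open>to_int_mod_ring\<close> in one direction and
  \<open>of_nat\<close> in the other.  Vectors indexed by a finite set \<open>I\<close> of positive integers are extensional
  functions on \<open>I\<close>; in particular \<open>[0,1)\<close> to the power \<open>s\<close> is \<open>{1..s} \<rightarrow>\<^sub>E {0..<1}\<close>, and the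
  vectors of positive integers indexed by \<open>u\<close> are \<open>u \<rightarrow>\<^sub>E {1..}\<close>.
\<close>

section \<open>Digits\<close>

definition nat_digit :: "nat \<Rightarrow> nat \<Rightarrow> nat \<Rightarrow> nat" where
  "nat_digit b k i = (k div b ^ i) mod b"

text \<open>
  \<open>real_digit b x a\<close> is the coefficient of \<open>b\<close> to the power \<open>-a\<close> (with \<open>a \<ge> 1\<close>) in the
  expansion of \<open>x\<close> in \<open>[0,1)\<close> that has infinitely many digits different from \<open>b - 1\<close>;
  see lemma \<open>real_digit_expansion\<close>.
\<close>

definition real_digit :: "nat \<Rightarrow> real \<Rightarrow> nat \<Rightarrow> nat" where
  "real_digit b x a = nat (\<lfloor>real b ^ a * x\<rfloor> mod int b)"

lemma real_digit_partial_sum: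
  assumes b: "2 \<le> b" and x: "0 \<le> x" "x < 1"
  shows "(\<Sum>a<n. real (real_digit b x (Suc a)) / real b ^ Suc a)
    = real_of_int \<lfloor>real b ^ n * x\<rfloor> / real b ^ n"
proof (induction n)
  case 0
  have "\<lfloor>x\<rfloor> = 0" using x by linarith
  then show ?case by simp
next
  case (Suc n)
  let ?F = "\<lambda>n. \<lfloor>real b ^ n * x\<rfloor>"
  have "?F (Suc n) div int b = \<lfloor>(real b ^ Suc n * x) / real_of_int (int b)\<rfloor>"
    by (simp only: floor_divide_real_eq_div of_nat_0_le_iff)
  also have "(real b ^ Suc n * x) / real_of_int (int b) = real b ^ n * x"
    using b by simp
  finally have q: "?F (Suc n) div int b = ?F n" .
  have "?F (Suc n) = int b * (?F (Suc n) div int b) + ?F (Suc n) mod int b"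
    by simp
  then have "?F (Suc n) = int b * ?F n + int (real_digit b x (Suc n))"
    using b by (simp only: q real_digit_def) simp
  then have F: "real_of_int (?F (Suc n)) = real b * real_of_int (?F n) + real (real_digit b x (Suc n))"
    by (metis of_int_add of_int_mult of_int_of_nat_eq)
  have "(\<Sum>a<Suc n. real (real_digit b x (Suc a)) / real b ^ Suc a)
      = real_of_int (?F n) / real b ^ n + real (real_digit b x (Suc n)) / real b ^ Suc n"
    using Suc.IH by simp
  also have "\<dots> = (real b * real_of_int (?F n) + real (real_digit b x (Suc n))) / real b ^ Suc n"
    using b by (simp add: field_simps)
  finally show ?case by (simp only: F)
qed

lemma real_digit_expansion:
  assumes b: "2 \<le> b" and x: "0 \<le> x" "x < 1"
  shows "real_digit b x a < b"
    and "(\<lambda>a. real (real_digit b x (Suc a)) / real b ^ Suc a) sums x"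
    and "infinite {a. 1 \<le> a \<and> real_digit b x a \<noteq> b - 1}"
proof -
  let ?d = "\<lambda>a. real (real_digit b x (Suc a)) / real b ^ Suc a"
  let ?F = "\<lambda>n. \<lfloor>real b ^ n * x\<rfloor>"
  have bpos: "real b ^ n > 0" for n using b by simp
  show "real_digit b x a < b"
    using b by (simp add: real_digit_def nat_less_iff)
  have "(\<lambda>n. (1 / real b) ^ n) \<longlonglongrightarrow> 0"
    using b by (intro LIMSEQ_realpow_zero) auto
  then have lim: "(\<lambda>n. x - (1 / real b) ^ n) \<longlonglongrightarrow> x"
    by (auto intro: tendsto_eq_intros)
  have up: "real_of_int (?F n) / real b ^ n \<le> x" for n
    using bpos[of n] by (simp add: divide_le_eq mult.commute)
  have lo: "x - (1 / real b) ^ n \<le> real_of_int (?F n) / real b ^ n" for n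
  proof -
    have "real b ^ n * x - 1 \<le> real_of_int (?F n)" by linarith
    then have "(real b ^ n * x - 1) / real b ^ n \<le> real_of_int (?F n) / real b ^ n"
      using bpos[of n] by (intro divide_right_mono) auto
    also have "(real b ^ n * x - 1) / real b ^ n = x - (1 / real b) ^ n"
      using bpos[of n] by (simp add: field_simps)
    finally show ?thesis .
  qed
  have "(\<lambda>n. real_of_int (?F n) / real b ^ n) \<longlonglongrightarrow> x"
    by (rule tendsto_sandwich[OF always_eventually always_eventually lim tendsto_const]) (use up lo in blast)+
  then show sums: "?d sums x"
    by (simp add: sums_def real_digit_partial_sum[OF assms] del: power_Suc)
  show "infinite {a. 1 \<le> a \<and> real_digit b x a \<noteq> b - 1}"
  proof
    assume "finite {a. 1 \<le> a \<and> real_digit b x a \<noteq> b - 1}"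
    then obtain n where n: "\<And>a. 1 \<le> a \<Longrightarrow> real_digit b x a \<noteq> b - 1 \<Longrightarrow> a \<le> n"
      by (auto simp: finite_nat_set_iff_bounded_le)
    have dig: "real_digit b x (Suc (a + n)) = b - 1" for a
      using n[of "Suc (a + n)"] by fastforce
    have "(\<lambda>a. ?d (a + n)) sums (x - real_of_int (?F n) / real b ^ n)"
      using sums_split_initial_segment[OF sums, of n]
      by (simp only: real_digit_partial_sum[OF assms])
    moreover have "?d (a + n) = (real b - 1) / real b ^ Suc n * (1 / real b) ^ a" for a
      using b by (simp add: dig of_nat_diff power_add field_simps)
    ultimately have "(\<lambda>a. (real b - 1) / real b ^ Suc n * (1 / real b) ^ a)
        sums (x - real_of_int (?F n) / real b ^ n)" by simp
    moreover have "(\<lambda>a. (real b - 1) / real b ^ Suc n * (1 / real b) ^ a)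
        sums ((real b - 1) / real b ^ Suc n * (1 / (1 - 1 / real b)))"
      using b by (intro sums_mult geometric_sums) auto
    ultimately have "x - real_of_int (?F n) / real b ^ n
        = (real b - 1) / real b ^ Suc n * (1 / (1 - 1 / real b))"
      by (rule sums_unique2)
    also have "\<dots> = 1 / real b ^ n" using b by (simp add: field_simps)
    finally have "real b ^ n * x = real_of_int (?F n) + 1"
      using bpos[of n] b by (simp add: field_simps)
    then show False by linarith
  qed
qed

section \<open>Polynomial lattices\<close>

definition trunc_poly :: "nat \<Rightarrow> nat \<Rightarrow> nat \<Rightarrow> 'p::prime_card mod_ring poly" where
  "trunc_poly b m k = (\<Sum>i<m. Polynomial.monom (of_nat (nat_digit b k i)) i)"

text \<open>Since \<open>k < b ^ k\<close>, the first \<open>k\<close> digits of \<open>k\<close> include all nonzero ones.\<close>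

definition nat_poly :: "nat \<Rightarrow> nat \<Rightarrow> 'p::prime_card mod_ring poly" where
  "nat_poly b k = trunc_poly b k k"

text \<open>
  Formal Laurent series in \<open>1/x\<close> are represented by \<open>fls\<close> with \<open>fls_X\<close> standing for \<open>1/x\<close>.
  Hence the polynomial variable \<open>x\<close> is mapped to \<open>fls_X_inv\<close>, and the coefficient of \<open>x\<close> to the
  power \<open>-l\<close> is \<open>fls_nth f l\<close>.
\<close>

definition laurent_of_poly :: "'a::field poly \<Rightarrow> 'a fls" where
  "laurent_of_poly f = poly (map_poly fls_const f) fls_X_inv"

definition laurent_trunc :: "nat \<Rightarrow> nat \<Rightarrow> 'p::prime_card mod_ring fls \<Rightarrow> real" where
  "laurent_trunc b m f =
    (\<Sum>l = 1..m. real_of_int (to_int_mod_ring (fls_nth f (int l))) / real b ^ l)"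

definition poly_lattice_point ::
  "nat \<Rightarrow> nat \<Rightarrow> nat \<Rightarrow> (nat \<Rightarrow> 'p::prime_card mod_ring poly) \<Rightarrow> 'p mod_ring poly \<Rightarrow> nat \<Rightarrow> nat \<Rightarrow> real"
where
  "poly_lattice_point b m t q p n = (\<lambda>j\<in>{1..t}.
    laurent_trunc b m (laurent_of_poly (nat_poly b n * q j) / laurent_of_poly p))"

definition zero_extend :: "nat set \<Rightarrow> nat set \<Rightarrow> (nat \<Rightarrow> nat) \<Rightarrow> nat \<Rightarrow> nat" where
  "zero_extend I u k = (\<lambda>j\<in>I. if j \<in> u then k j else 0)"

definition dual_lattice ::
  "nat \<Rightarrow> nat \<Rightarrow> nat \<Rightarrow> (nat \<Rightarrow> 'p::prime_card mod_ring poly) \<Rightarrow> 'p mod_ring poly \<Rightarrow> (nat \<Rightarrow> nat) set"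
where
  "dual_lattice b m t q p =
    {k \<in> {1..t} \<rightarrow>\<^sub>E UNIV. p dvd (\<Sum>j = 1..t. trunc_poly b m (k j) * q j)}"

section \<open>Digit interlacing\<close>

text \<open>The summation index \<open>a\<close> starts at \<open>0\<close>, i.e. it is the usual index \<open>a\<close> minus one.\<close>

definition interlace :: "nat \<Rightarrow> nat \<Rightarrow> (nat \<Rightarrow> real) \<Rightarrow> real" where
  "interlace b d y =
    (\<Sum>a. \<Sum>r = 1..d. real (real_digit b (y r) (Suc a)) / real b ^ (r + a * d))"

definition interlace_vec :: "nat \<Rightarrow> nat \<Rightarrow> nat \<Rightarrow> (nat \<Rightarrow> real) \<Rightarrow> nat \<Rightarrow> real" where
  "interlace_vec b d s y = (\<lambda>j\<in>{1..s}. interlace b d (\<lambda>r. y ((j - 1) * d + r)))"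

definition interlaced_lattice_point ::
  "nat \<Rightarrow> nat \<Rightarrow> nat \<Rightarrow> nat \<Rightarrow> (nat \<Rightarrow> 'p::prime_card mod_ring poly) \<Rightarrow> 'p mod_ring poly \<Rightarrow>
    nat \<Rightarrow> nat \<Rightarrow> real"
where
  "interlaced_lattice_point b m d s q p n =
    interlace_vec b d s (poly_lattice_point b m (d * s) q p n)"

definition block_support :: "nat \<Rightarrow> nat \<Rightarrow> nat set \<Rightarrow> nat set" where
  "block_support d s u = {j \<in> {1..s}. u \<inter> {(j - 1) * d + 1..j * d} \<noteq> {}}"

section \<open>Walsh functions\<close>

definition wal :: "nat \<Rightarrow> nat \<Rightarrow> real \<Rightarrow> complex" where
  "wal b k x = exp (2 * of_real pi * \<i> / of_nat b) ^ (\<Sum>i<k. real_digit b x (Suc i) * nat_digit b k i)"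

definition wal_vec :: "nat \<Rightarrow> nat \<Rightarrow> (nat \<Rightarrow> nat) \<Rightarrow> (nat \<Rightarrow> real) \<Rightarrow> complex" where
  "wal_vec b s k x = (\<Prod>j = 1..s. wal b (k j) (x j))"

definition cube :: "nat \<Rightarrow> (nat \<Rightarrow> real) measure" where
  "cube s = (\<Pi>\<^sub>M j\<in>{1..s}. restrict_space lborel {0..<1})"

definition walsh_coeff :: "nat \<Rightarrow> nat \<Rightarrow> ((nat \<Rightarrow> real) \<Rightarrow> real) \<Rightarrow> (nat \<Rightarrow> nat) \<Rightarrow> complex" where
  "walsh_coeff b s f l = (LINT x|cube s. of_real (f x) * cnj (wal_vec b s l x))"

section \<open>Weighted Walsh spaces\<close>

text \<open>
  \<open>digit_positions b k\<close> consists of the \<open>a\<close> such that \<open>b\<close> to the power \<open>a - 1\<close> occurs in \<open>k\<close>;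
  \<open>\<mu>\<close> adds up the \<open>\<alpha>\<close> largest of them (all of them if there are fewer).
\<close>

definition digit_positions :: "nat \<Rightarrow> nat \<Rightarrow> nat set" where
  "digit_positions b k = {a \<in> {1..k}. nat_digit b k (a - 1) \<noteq> 0}"

definition mu :: "nat \<Rightarrow> nat \<Rightarrow> nat \<Rightarrow> nat" where
  "mu b \<alpha> k = sum_list (take \<alpha> (rev (sorted_list_of_set (digit_positions b k))))"

definition r_alpha :: "nat \<Rightarrow> nat \<Rightarrow> nat \<Rightarrow> real" where
  "r_alpha b \<alpha> k = 1 / real b ^ mu b \<alpha> k"

definition r_tilde :: "nat \<Rightarrow> nat \<Rightarrow> nat \<Rightarrow> nat \<Rightarrow> real" where
  "r_tilde b d j k = (if k = 0 then 1
    else real b powi (- int d * int (mu b 1 k) - int j + int d * \<lceil>real j / real d\<rceil>))"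

definition r_tilde_vec :: "nat \<Rightarrow> nat \<Rightarrow> nat set \<Rightarrow> (nat \<Rightarrow> nat) \<Rightarrow> real" where
  "r_tilde_vec b d u k = (\<Prod>j\<in>u. r_tilde b d j (k j))"

text \<open>
  The outer supremum ranges over a finite set, so it is a maximum (and \<open>0\<close> if all weights vanish).
\<close>

definition walsh_norm ::
  "nat \<Rightarrow> nat \<Rightarrow> nat \<Rightarrow> (nat set \<Rightarrow> real) \<Rightarrow> ((nat \<Rightarrow> real) \<Rightarrow> real) \<Rightarrow> ennreal" where
  "walsh_norm b s \<alpha> \<gamma> f = (SUP v\<in>{v. v \<subseteq> {1..s} \<and> \<gamma> v \<noteq> 0}.
    ennreal (1 / \<gamma> v) *
      (SUP l\<in>v \<rightarrow>\<^sub>E {1..}.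
        ennreal (cmod (walsh_coeff b s f (zero_extend {1..s} v l)) / (\<Prod>j\<in>v. r_alpha b \<alpha> (l j)))))"

text \<open>
  The norm does not see components with weight zero; as usual for weighted spaces, these are
  required to vanish (otherwise the unit ball would contain functions with arbitrarily large
  integration error).  For \<open>v = {}\<close>, where only the mean of \<open>f\<close> is concerned, no such condition is
  needed.  The last condition says that the Walsh series converges absolutely to \<open>f\<close> at every point
  of the half-open cube.
\<close>

definition walsh_space ::
  "nat \<Rightarrow> nat \<Rightarrow> nat \<Rightarrow> (nat set \<Rightarrow> real) \<Rightarrow> ((nat \<Rightarrow> real) \<Rightarrow> real) set" where
  "walsh_space b s \<alpha> \<gamma> = {f.
    f \<in> borel_measurable (cube s) \<and> integrable (cube s) (\<lambda>x. (f x)\<^sup>2) \<and>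
    walsh_norm b s \<alpha> \<gamma> f < \<infinity> \<and>
    (\<forall>v l. v \<subseteq> {1..s} \<and> v \<noteq> {} \<and> \<gamma> v = 0 \<and> l \<in> v \<rightarrow>\<^sub>E {1..} \<longrightarrow>
      walsh_coeff b s f (zero_extend {1..s} v l) = 0) \<and>
    (\<forall>x\<in>{1..s} \<rightarrow>\<^sub>E {0..<1}.
      (\<lambda>l. cmod (walsh_coeff b s f l * wal_vec b s l x)) summable_on ({1..s} \<rightarrow>\<^sub>E UNIV) \<and>
      ((\<lambda>l. walsh_coeff b s f l * wal_vec b s l x) has_sum of_real (f x)) ({1..s} \<rightarrow>\<^sub>E UNIV))}"

definition worst_case_error ::
  "nat \<Rightarrow> nat \<Rightarrow> nat \<Rightarrow> (nat set \<Rightarrow> real) \<Rightarrow> nat \<Rightarrow> (nat \<Rightarrow> nat \<Rightarrow> real) \<Rightarrow> ennreal" where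
  "worst_case_error b s \<alpha> \<gamma> N P = (SUP f\<in>{f \<in> walsh_space b s \<alpha> \<gamma>. walsh_norm b s \<alpha> \<gamma> f \<le> 1}.
    ennreal \<bar>(\<Sum>n<N. f (P n)) / real N - (LINT x|cube s. f x)\<bar>)"

end

theory Submission
  imports Defs
begin

text \<open>
  Evaluating the Walsh series of \<open>f\<close> at the quadrature points turns the integration error into the sum over
  \<open>l \<noteq> 0\<close> of the Walsh coefficient at \<open>l\<close> times the mean of \<open>wal_l\<close> over the point set.  Distributing
  the digits of each component of \<open>l\<close> cyclically over \<open>d\<close> numbers gives an injective map \<open>l \<mapsto> k\<close> such
  that \<open>wal_l\<close> at an interlaced point is \<open>wal_k\<close> at the original lattice point.  The mean is then a
  character sum over the polynomials of degree less than \<open>m\<close>, which vanishes unless \<open>k\<close> lies in the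
  dual lattice.  Finally, the leading digits of the nonzero \<open>k_j\<close> in one block are at most
  \<open>d \<le> \<alpha>\<close> distinct digits of one component of \<open>l\<close>, so \<open>\<mu>_\<alpha>\<close> is at least the sum of their
  positions; this sum is the exponent in the product of the weights of the \<open>k_j\<close>.
\<close>

section \<open>Digit expansions, interlacing and Walsh functions\<close>

lemma nat_digit_0: "nat_digit b k 0 = k mod b"
  by (simp add: nat_digit_def)

lemma nat_digit_Suc: "nat_digit b k (Suc i) = nat_digit b (k div b) i"
  by (simp add: nat_digit_def div_mult2_eq)

lemma nat_digit_eq_0:
  assumes "2 \<le> b" "k \<le> i"
  shows "nat_digit b k i = 0"
proof -
  have "i < b ^ i"
    using assms by (intro power_gt_expt) auto
  then show ?thesis using assms by (simp add: nat_digit_def)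
qed

lemma sum_nat_digit:
  assumes "k < b ^ n"
  shows "(\<Sum>i<n. nat_digit b k i * b ^ i) = k"
  using assms
proof (induction n arbitrary: k)
  case (Suc n)
  have "k div b < b ^ n"
    using Suc.prems by (simp add: less_mult_imp_div_less mult.commute)
  then have "(\<Sum>i<n. nat_digit b (k div b) i * b ^ i) = k div b"
    by (rule Suc.IH)
  moreover have "(\<Sum>i<Suc n. nat_digit b k i * b ^ i)
      = k mod b + (\<Sum>i<n. nat_digit b (k div b) i * b ^ i) * b"
    by (simp add: sum.lessThan_Suc_shift nat_digit_0 nat_digit_Suc sum_distrib_left mult_ac del: sum.lessThan_Suc)
  ultimately show ?case by simp
qed simp

lemma sum_digits_less:
  fixes c :: "nat \<Rightarrow> nat"
  assumes "\<And>i. c i < b"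
  shows "(\<Sum>i<n. c i * b ^ i) < b ^ n"
proof (induction n)
  case (Suc n)
  have "(\<Sum>i<Suc n. c i * b ^ i) < b ^ n + c n * b ^ n" using Suc by simp
  also have "\<dots> = Suc (c n) * b ^ n" by simp
  also have "\<dots> \<le> b * b ^ n" using assms[of n] by (intro mult_right_mono) auto
  finally show ?case by simp
qed simp

lemma nat_digit_sum:
  assumes "\<And>i. c i < b"
  shows "nat_digit b (\<Sum>i<n. c i * b ^ i) j = (if j < n then c j else 0)"
  using assms
proof (induction n arbitrary: c j)
  case 0
  then show ?case by (simp add: nat_digit_def)
next
  case (Suc n)
  have "(\<Sum>i<Suc n. c i * b ^ i) = c 0 + b * (\<Sum>i<n. c (Suc i) * b ^ i)"
    by (simp add: sum.lessThan_Suc_shift sum_distrib_left mult_ac del: sum.lessThan_Suc)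
  moreover have "c 0 < b" by (rule Suc.prems)
  moreover have "nat_digit b (\<Sum>i<n. c (Suc i) * b ^ i) j' = (if j' < n then c (Suc j') else 0)" for j'
    using Suc.prems by (intro Suc.IH)
  ultimately show ?case
    by (cases j) (simp_all add: nat_digit_0 nat_digit_Suc del: sum.lessThan_Suc)
qed

lemma nat_digit_ext:
  assumes "2 \<le> b" "\<And>i. nat_digit b k i = nat_digit b l i"
  shows "k = l"
proof -
  \<comment> \<open>The exponent \<open>k + l\<close> gives both numbers a common digit length, so
    one digit sum reconstructs each of them.\<close>
  have less: "n < b ^ (k + l)" if "n \<le> k + l" for n
  proof -
    have "k + l < b ^ (k + l)"
      using assms(1) by (intro power_gt_expt) auto
    then show ?thesis using that by simp
  qed
  have "k = (\<Sum>i<k + l. nat_digit b k i * b ^ i)"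
    by (rule sum_nat_digit[symmetric], rule less) simp
  also have "\<dots> = l"
    unfolding assms(2) by (rule sum_nat_digit, rule less) simp
  finally show ?thesis .
qed

lemma real_digit_less: "2 \<le> b \<Longrightarrow> real_digit b x a < b"
  by (simp add: real_digit_def nat_less_iff)

text \<open>A finite digit sum continues with zeros, so it is already the admissible expansion and
  its digits are the coefficients. The induction peels off the leading digit: the number is
  \<open>(c 0 + y) / b\<close> with \<open>y\<close> in [0,1) built from the remaining
  coefficients.\<close>

lemma real_digit_sum:
  fixes c :: "nat \<Rightarrow> nat" and n :: nat and x :: real
  assumes "2 \<le> b" "\<And>i. c i < b"
  defines "x \<equiv> (\<Sum>i<n. real (c i) / real b ^ Suc i)"
  shows "0 \<le> x" "x < 1" "real_digit b x (Suc j) = (if j < n then c j else 0)"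
proof -
  have "0 \<le> x \<and> x < 1 \<and> real_digit b x (Suc j) = (if j < n then c j else 0)"
    unfolding x_def using assms(2)
  proof (induction n arbitrary: c j)
    case 0
    then show ?case by (simp add: real_digit_def)
  next
    case (Suc n)
    define y where "y = (\<Sum>i<n. real (c (Suc i)) / real b ^ Suc i)"
    have y: "0 \<le> y" "y < 1"
      and dig: "\<And>j. real_digit b y (Suc j) = (if j < n then c (Suc j) else 0)"
      using Suc.IH[of "\<lambda>i. c (Suc i)"] Suc.prems unfolding y_def by auto
    have eq: "(\<Sum>i<Suc n. real (c i) / real b ^ Suc i) = (real (c 0) + y) / real b"
      by (simp add: y_def sum.lessThan_Suc_shift sum_divide_distrib add_divide_distrib mult_ac del: sum.lessThan_Suc)
    have c0: "c 0 + 1 \<le> b" using Suc.prems[of 0] by simp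
    then have "real (c 0) + 1 \<le> real b" by linarith
    then have "real (c 0) + y < real b" using y by linarith
    then have bounds: "0 \<le> (real (c 0) + y) / real b" "(real (c 0) + y) / real b < 1"
      using assms(1) y by auto
    have "real_digit b ((real (c 0) + y) / real b) (Suc j) = (if j < Suc n then c j else 0)"
    proof (cases j)
      case 0
      have "\<lfloor>real (c 0) + y\<rfloor> = int (c 0)" using y by linarith
      then show ?thesis using 0 assms(1) c0 by (simp add: real_digit_def)
    next
      case (Suc i)
      have bne: "b \<noteq> 0" using assms(1) by simp
      \<comment> \<open>After scaling, the leading digit contributes \<open>b ^ Suc i * c 0\<close>,
        a multiple of \<open>b\<close> that disappears modulo \<open>b\<close>; what remains is the
        digit of the tail \<open>y\<close> one place earlier.\<close>
      have "real b ^ Suc (Suc i) * ((real (c 0) + y) / real b) =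
          of_int (int b ^ Suc i * int (c 0)) + real b ^ Suc i * y"
        using bne by (simp add: divide_simps) (simp add: algebra_simps)
      then have "\<lfloor>real b ^ Suc (Suc i) * ((real (c 0) + y) / real b)\<rfloor> =
          int b ^ Suc i * int (c 0) + \<lfloor>real b ^ Suc i * y\<rfloor>"
        by (metis add.commute floor_add_int)
      also have "\<dots> mod int b = \<lfloor>real b ^ Suc i * y\<rfloor> mod int b"
        by (simp add: mod_add_left_eq[symmetric] mult.assoc)
      finally have "real_digit b ((real (c 0) + y) / real b) (Suc j) = real_digit b y (Suc i)"
        by (simp only: real_digit_def Suc)
      then show ?thesis using Suc dig by simp
    qed
    then show ?case unfolding eq using bounds by blast
  qed
  then show "0 \<le> x" "x < 1" "real_digit b x (Suc j) = (if j < n then c j else 0)" by auto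
qed

lemma sum_nat_blocks:
  fixes g :: "nat \<Rightarrow> 'a::comm_monoid_add"
  shows "(\<Sum>i<m * d. g i) = (\<Sum>a<m. \<Sum>r<d. g (r + a * d))"
proof -
  have "sum g {a * d..<a * d + d} = (\<Sum>r<d. g (r + a * d))" for a
    using sum.shift_bounds_nat_ivl[of g 0 "a * d" d] by (simp add: add.commute lessThan_atLeast0)
  then show ?thesis by (simp add: sum.nat_group[symmetric])
qed

lemma prod_nat_blocks:
  fixes g :: "nat \<Rightarrow> 'a::comm_monoid_mult"
  shows "(\<Prod>i<m * d. g i) = (\<Prod>a<m. \<Prod>r<d. g (r + a * d))"
proof -
  have "prod g {a * d..<a * d + d} = (\<Prod>r<d. g (r + a * d))" for a
    using prod.shift_bounds_nat_ivl[of g 0 "a * d" d] by (simp add: add.commute lessThan_atLeast0)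
  then show ?thesis by (simp add: prod.nat_group[symmetric])
qed

text \<open>By \<open>fin\<close> the interlacing series is a finite digit sum, so
  \<open>real_digit_sum\<close> identifies its digits. Counted from 0, position
  \<open>i = r + a * d\<close> holds digit \<open>a\<close> of component \<open>r\<close>, which is
  why \<open>i mod d\<close> and \<open>i div d\<close> appear.\<close>

lemma interlace_digits:
  assumes b: "2 \<le> b" and d: "0 < d"
    and fin: "\<And>r a. r < d \<Longrightarrow> m \<le> a \<Longrightarrow> real_digit b (y (Suc r)) (Suc a) = 0"
  shows "interlace b d y \<in> {0..<1}"
    and "real_digit b (interlace b d y) (Suc i) = real_digit b (y (Suc (i mod d))) (Suc (i div d))"
proof -
  define c where "c = (\<lambda>i. real_digit b (y (Suc (i mod d))) (Suc (i div d)))"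
  have sub: "(\<Sum>r = 1..d. real (real_digit b (y r) (Suc a)) / real b ^ (r + a * d))
      = (\<Sum>r<d. real (c (r + a * d)) / real b ^ Suc (r + a * d))" for a
  proof (rule sum.reindex_bij_witness[of _ Suc "\<lambda>r. r - 1"])
    fix r assume "r \<in> {1..d}"
    then obtain r' where "r = Suc r'" "r' < d" by (cases r) auto
    then show "real (c (r - 1 + a * d)) / real b ^ Suc (r - 1 + a * d)
        = real (real_digit b (y r) (Suc a)) / real b ^ (r + a * d)"
      by (simp add: c_def)
  qed auto
  have "interlace b d y = (\<Sum>a. \<Sum>r<d. real (c (r + a * d)) / real b ^ Suc (r + a * d))"
    by (simp only: interlace_def sub)
  also have "\<dots> = (\<Sum>a<m. \<Sum>r<d. real (c (r + a * d)) / real b ^ Suc (r + a * d))"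
    by (rule suminf_finite) (auto simp: c_def fin)
  also have "\<dots> = (\<Sum>i<m * d. real (c i) / real b ^ Suc i)"
    by (simp only: sum_nat_blocks)
  finally have eq: "interlace b d y = (\<Sum>i<m * d. real (c i) / real b ^ Suc i)" .
  have c: "c i < b" for i using b by (simp add: c_def real_digit_less)
  show "interlace b d y \<in> {0..<1}"
    using real_digit_sum(1,2)[of b c "m * d", OF b c] by (simp add: eq)
  have "c i = 0" if "m * d \<le> i"
  proof -
    have "m \<le> i div d" using that d by (simp add: less_eq_div_iff_mult_less_eq)
    then show ?thesis using d by (simp add: c_def fin)
  qed
  then show "real_digit b (interlace b d y) (Suc i) = real_digit b (y (Suc (i mod d))) (Suc (i div d))"
    using real_digit_sum(3)[of b c "m * d" i, OF b c] by (auto simp: eq c_def)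
qed

text \<open>The exponent in \<open>wal\<close> stops at the digits of \<open>k\<close>; any cutoff
  past which all products vanish gives the same sum, whether the digits of \<open>k\<close> or those
  of \<open>x\<close> are the ones that end. Both cutoffs are compared with
  \<open>k + K\<close>.\<close>

lemma wal_eq_power:
  assumes "2 \<le> b" "\<And>i. K \<le> i \<Longrightarrow> real_digit b x (Suc i) * nat_digit b k i = 0"
  shows "wal b k x = exp (2 * of_real pi * \<i> / of_nat b) ^
    (\<Sum>i<K. real_digit b x (Suc i) * nat_digit b k i)"
proof -
  let ?g = "\<lambda>i. real_digit b x (Suc i) * nat_digit b k i"
  have "sum ?g {..<k} = sum ?g {..<k + K}"
    using assms(1) by (intro sum.mono_neutral_left) (auto simp: nat_digit_eq_0)
  also have "\<dots> = sum ?g {..<K}"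
    using assms(2) by (intro sum.mono_neutral_right) auto
  finally show ?thesis by (simp add: wal_def)
qed

text \<open>
  The index \<open>r\<close> runs from \<open>0\<close> to \<open>d - 1\<close>.  The sum may stop at \<open>k\<close> because all digits of \<open>k\<close> from
  position \<open>k\<close> on vanish.
\<close>

definition deinterlace :: "nat \<Rightarrow> nat \<Rightarrow> nat \<Rightarrow> nat \<Rightarrow> nat" where
  "deinterlace b d r k = (\<Sum>a<k. nat_digit b k (r + a * d) * b ^ a)"

text \<open>Blocks and offsets are counted from 0 but components from 1: component \<open>j\<close>
  sits in block \<open>(j - 1) div d\<close> at offset \<open>(j - 1) mod d\<close>.\<close>

definition deinterlace_vec :: "nat \<Rightarrow> nat \<Rightarrow> nat \<Rightarrow> (nat \<Rightarrow> nat) \<Rightarrow> nat \<Rightarrow> nat" where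
  "deinterlace_vec b d s l = (\<lambda>j\<in>{1..d * s}. deinterlace b d ((j - 1) mod d) (l (Suc ((j - 1) div d))))"

lemma nat_digit_less: "2 \<le> b \<Longrightarrow> nat_digit b k i < b"
  by (simp add: nat_digit_def)

lemma nat_digit_deinterlace:
  assumes "2 \<le> b" "0 < d"
  shows "nat_digit b (deinterlace b d r k) a = nat_digit b k (r + a * d)"
proof -
  \<comment> \<open>From the cutoff \<open>k\<close> on, the digit of the deinterlaced number is 0,
    and so is that of \<open>k\<close>, because the position \<open>r + a * d\<close> is at least
    \<open>k\<close> too.\<close>
  have "k \<le> r + a * d" if "k \<le> a"
    using that assms(2) by (simp add: trans_le_add2 mult_le_mono[of k a 1 d, simplified])
  then show ?thesis
    using assms unfolding deinterlace_def
    by (subst nat_digit_sum) (auto simp: nat_digit_less nat_digit_eq_0)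
qed

text \<open>The exponent pairs the digits of \<open>l\<close> with those of the interlaced point.
  Grouping the positions by their residue \<open>r\<close> modulo \<open>d\<close> leaves, for each
  \<open>r\<close>, the digits of \<open>deinterlace b d r l\<close> paired with those of one
  component.\<close>

lemma wal_interlace:
  assumes b: "2 \<le> b" and d: "0 < d"
    and fin: "\<And>r a. r < d \<Longrightarrow> m \<le> a \<Longrightarrow> real_digit b (y (Suc r)) (Suc a) = 0"
  shows "wal b l (interlace b d y) = (\<Prod>r<d. wal b (deinterlace b d r l) (y (Suc r)))"
proof -
  let ?w = "exp (2 * of_real pi * \<i> / of_nat b) :: complex"
  have "l \<le> l * d" using d by simp
  have dig: "real_digit b (interlace b d y) (Suc (r + a * d)) = real_digit b (y (Suc r)) (Suc a)"
    if "r < d" for r a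
    using interlace_digits(2)[of b d m y "r + a * d"] b d fin that by simp
  \<comment> \<open>The sum is extended to \<open>l * d\<close> positions so that it splits into
    complete blocks of length \<open>d\<close>.\<close>
  from b \<open>l \<le> l * d\<close> have "nat_digit b l i = 0" if "l * d \<le> i" for i
    using that by (intro nat_digit_eq_0) linarith+
  with b have "wal b l (interlace b d y) =
      ?w ^ (\<Sum>i<l * d. real_digit b (interlace b d y) (Suc i) * nat_digit b l i)"
    by (intro wal_eq_power) simp_all
  also have "(\<Sum>i<l * d. real_digit b (interlace b d y) (Suc i) * nat_digit b l i) =
      (\<Sum>a<l. \<Sum>r<d. real_digit b (y (Suc r)) (Suc a) * nat_digit b l (r + a * d))"
    unfolding sum_nat_blocks by (intro sum.cong refl) (simp add: dig)
  also have "\<dots> = (\<Sum>r<d. \<Sum>a<l. real_digit b (y (Suc r)) (Suc a) * nat_digit b (deinterlace b d r l) a)"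
    unfolding nat_digit_deinterlace[OF b d] by (rule sum.swap)
  finally have "wal b l (interlace b d y) = (\<Prod>r<d. ?w ^
      (\<Sum>a<l. real_digit b (y (Suc r)) (Suc a) * nat_digit b (deinterlace b d r l) a))"
    by (simp add: power_sum)
  also have "\<dots> = (\<Prod>r<d. wal b (deinterlace b d r l) (y (Suc r)))"
  proof (intro prod.cong refl wal_eq_power[symmetric] b)
    fix r a assume "l \<le> a"
    then have "l \<le> r + a * d"
      using d by (simp add: trans_le_add2 mult_le_mono[of l a 1 d, simplified])
    then show "real_digit b (y (Suc r)) (Suc a) * nat_digit b (deinterlace b d r l) a = 0"
      using b d by (simp add: nat_digit_deinterlace nat_digit_eq_0)
  qed
  finally show ?thesis .
qed

lemma prod_atLeastAtMost_1_eq: "(\<Prod>j = 1..n. g j) = (\<Prod>i<n. g (Suc i))"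
  for g :: "nat \<Rightarrow> 'a::comm_monoid_mult"
  by (rule prod.reindex_bij_witness[of _ Suc "\<lambda>r. r - 1"]) auto

lemma block_index_less: "i < s \<Longrightarrow> r < d \<Longrightarrow> r + i * d < d * (s :: nat)"
proof -
  assume "i < s" "r < d"
  then have "r + i * d < Suc i * d" by simp
  also have "\<dots> \<le> s * d" using \<open>i < s\<close> by (intro mult_le_mono1) simp
  finally show ?thesis by (simp add: mult.commute)
qed

text \<open>Writing the long index as \<open>Suc (r + i * d)\<close> gathers the factors of block
  \<open>i\<close>, to which \<open>wal_interlace\<close> applies.\<close>

lemma wal_vec_interlace_vec:
  assumes b: "2 \<le> b" and d: "0 < d"
    and fin: "\<And>j a. j \<in> {1..d * s} \<Longrightarrow> m \<le> a \<Longrightarrow> real_digit b (y j) (Suc a) = 0"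
  shows "wal_vec b s l (interlace_vec b d s y) = wal_vec b (d * s) (deinterlace_vec b d s l) y"
proof -
  have "wal_vec b (d * s) (deinterlace_vec b d s l) y =
      (\<Prod>i<s * d. wal b (deinterlace_vec b d s l (Suc i)) (y (Suc i)))"
    by (simp only: wal_vec_def prod_atLeastAtMost_1_eq mult.commute)
  also have "\<dots> = (\<Prod>i<s. \<Prod>r<d. wal b (deinterlace_vec b d s l (Suc (r + i * d))) (y (Suc (r + i * d))))"
    by (rule prod_nat_blocks)
  also have "\<dots> = (\<Prod>i<s. \<Prod>r<d. wal b (deinterlace b d r (l (Suc i))) (y (Suc (r + i * d))))"
  proof (intro prod.cong refl)
    fix i r assume "i \<in> {..<s}" "r \<in> {..<d}"
    then show "wal b (deinterlace_vec b d s l (Suc (r + i * d))) (y (Suc (r + i * d))) =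
        wal b (deinterlace b d r (l (Suc i))) (y (Suc (r + i * d)))"
      using block_index_less[of i s r d] d by (simp add: deinterlace_vec_def Suc_le_eq)
  qed
  also have "\<dots> = (\<Prod>i<s. wal b (l (Suc i)) (interlace b d (\<lambda>r. y (i * d + r))))"
  proof (intro prod.cong refl)
    fix i assume i: "i \<in> {..<s}"
    have "wal b (l (Suc i)) (interlace b d (\<lambda>r. y (i * d + r))) =
       (\<Prod>r<d. wal b (deinterlace b d r (l (Suc i))) (y (i * d + Suc r)))"
    proof (rule wal_interlace[OF b d])
      fix r a assume "r < d" "m \<le> a"
      then show "real_digit b (y (i * d + Suc r)) (Suc a) = 0"
        using block_index_less[of i s r d] i by (intro fin) auto
    qed
    then show "(\<Prod>r<d. wal b (deinterlace b d r (l (Suc i))) (y (Suc (r + i * d)))) =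
        wal b (l (Suc i)) (interlace b d (\<lambda>r. y (i * d + r)))"
      by (simp add: add.commute)
  qed
  also have "\<dots> = wal_vec b s l (interlace_vec b d s y)"
    by (simp add: wal_vec_def prod_atLeastAtMost_1_eq interlace_vec_def del: One_nat_def)
  finally show ?thesis by simp
qed

section \<open>Characters on polynomial lattices\<close>

lemma laurent_of_poly_pCons:
  "laurent_of_poly (pCons a f) = fls_const a + fls_X_inv * laurent_of_poly f"
  by (cases "a = 0 \<and> f = 0") (auto simp: laurent_of_poly_def map_poly_pCons)

lemma laurent_of_poly_0 [simp]: "laurent_of_poly 0 = 0"
  by (simp add: laurent_of_poly_def)

lemma laurent_of_poly_nth:
  "fls_nth (laurent_of_poly f) k = (if k \<le> 0 then Polynomial.coeff f (nat (- k)) else 0)"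
proof (induction f arbitrary: k)
  case (pCons a f)
  show ?case
  proof (cases "k \<le> - 1")
    case True
    then have "nat (- k) = Suc (nat (- (k + 1)))" by linarith
    then show ?thesis
      using True by (simp add: laurent_of_poly_pCons fls_X_inv_times_conv_shift pCons.IH)
  next
    case False
    then show ?thesis
      by (auto simp: laurent_of_poly_pCons fls_X_inv_times_conv_shift pCons.IH)
  qed
qed simp

lemma laurent_of_poly_add: "laurent_of_poly (f + g) = laurent_of_poly f + laurent_of_poly g"
  by (intro fls_eqI) (simp add: laurent_of_poly_nth)

lemma laurent_of_poly_smult: "laurent_of_poly (Polynomial.smult a f) = fls_const a * laurent_of_poly f"
  by (intro fls_eqI) (simp add: laurent_of_poly_nth)

lemma laurent_of_poly_mult: "laurent_of_poly (f * g) = laurent_of_poly f * laurent_of_poly g"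
proof (induction f)
  case (pCons a f)
  have "laurent_of_poly (pCons a f * g) =
      laurent_of_poly (Polynomial.smult a g) + laurent_of_poly (pCons 0 (f * g))"
    by (simp only: mult_pCons_left laurent_of_poly_add)
  then show ?case
    by (simp add: laurent_of_poly_smult laurent_of_poly_pCons pCons.IH algebra_simps)
qed simp

lemma laurent_of_poly_sum: "laurent_of_poly (\<Sum>i\<in>A. f i) = (\<Sum>i\<in>A. laurent_of_poly (f i))"
  by (induction A rule: infinite_finite_induct) (simp_all add: laurent_of_poly_add)

lemma laurent_of_poly_monom_times_nth:
  "fls_nth (laurent_of_poly (Polynomial.monom a i) * F) k = a * fls_nth F (k + int i)"
proof (induction i arbitrary: k)
  case 0
  then show ?case by (simp add: monom_0 laurent_of_poly_pCons)
next
  case (Suc i)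
  have "laurent_of_poly (Polynomial.monom a (Suc i)) * F =
      fls_X_inv * (laurent_of_poly (Polynomial.monom a i) * F)"
    by (simp add: monom_Suc laurent_of_poly_pCons mult.assoc)
  also have "\<dots> = fls_shift 1 (laurent_of_poly (Polynomial.monom a i) * F)"
    by (rule fls_X_inv_times_conv_shift)
  finally show ?case by (simp add: Suc.IH add_ac)
qed

lemma laurent_of_poly_eq_0_iff: "laurent_of_poly f = 0 \<longleftrightarrow> f = 0"
proof
  assume *: "laurent_of_poly f = 0"
  show "f = 0"
  proof (rule poly_eqI)
    fix n
    show "Polynomial.coeff f n = Polynomial.coeff 0 n"
      using laurent_of_poly_nth[of f "- int n"] * by simp
  qed
qed simp

lemma fls_subdegree_laurent_of_poly: "fls_subdegree (laurent_of_poly f) = - int (Polynomial.degree f)"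
proof (cases "f = 0")
  case False
  then show ?thesis
    by (intro fls_subdegree_eqI) (auto simp: laurent_of_poly_nth intro!: coeff_eq_0)
qed simp

lemma fls_sum_nth: "fls_nth (\<Sum>i\<in>A. f i) k = (\<Sum>i\<in>A. fls_nth (f i) k)"
  by (induction A rule: infinite_finite_induct) simp_all

text \<open>The coefficient of 1/x in a product pairs digit \<open>i\<close> of \<open>k\<close>
  with the coefficient of the power \<open>-(i + 1)\<close> of x in \<open>F\<close>. This is
  exactly the exponent of a Walsh function at a truncated series.\<close>

lemma laurent_trunc_poly_times_nth:
  "fls_nth (laurent_of_poly (trunc_poly b m k) * F) 1 =
    (\<Sum>i<m. of_nat (nat_digit b k i) * fls_nth F (int (Suc i)))"
proof -
  have "laurent_of_poly (trunc_poly b m k) * F =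
      (\<Sum>i<m. laurent_of_poly (Polynomial.monom (of_nat (nat_digit b k i)) i) * F)"
    by (simp add: trunc_poly_def laurent_of_poly_sum sum_distrib_right)
  then show ?thesis
    by (simp add: laurent_of_poly_monom_times_nth fls_sum_nth)
qed

text \<open>The residue pairing is nondegenerate modulo \<open>p\<close>: the fractional part
  \<open>r / p\<close> of \<open>g / p\<close> is nonzero and starts at the power
  \<open>1 + t\<close> of 1/x, so multiplication by the monomial of degree \<open>t\<close> moves
  its leading coefficient to the coefficient of 1/x.\<close>

lemma residue_monom_times_nonzero:
  fixes g p :: "'a::{field} poly"
  assumes "p \<noteq> 0" "\<not> p dvd g"
  obtains t where "t < Polynomial.degree p"
    "fls_nth (laurent_of_poly (Polynomial.monom 1 t * g) / laurent_of_poly p) 1 \<noteq> 0"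
proof -
  define r where "r = g mod p"
  have r: "r \<noteq> 0" using assms by (simp add: r_def mod_eq_0_iff_dvd)
  have deg: "Polynomial.degree r < Polynomial.degree p"
    using degree_mod_less[of p g] assms r by (auto simp: r_def)
  let ?P = "laurent_of_poly p"
  define t where "t = Polynomial.degree p - Suc (Polynomial.degree r)"
  have P: "?P \<noteq> 0" using assms by (simp add: laurent_of_poly_eq_0_iff)
  have R: "laurent_of_poly r \<noteq> 0" using r by (simp add: laurent_of_poly_eq_0_iff)
  have "laurent_of_poly g = laurent_of_poly (p * (g div p) + r)"
    by (simp add: r_def)
  then have quot: "laurent_of_poly g / ?P = laurent_of_poly (g div p) + laurent_of_poly r / ?P"
    using P by (simp add: laurent_of_poly_add laurent_of_poly_mult add_divide_distrib)
  have "fls_subdegree (laurent_of_poly r / ?P) = 1 + int t"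
    using P R deg by (simp add: fls_divide_subdegree fls_subdegree_laurent_of_poly t_def)
  then have nz: "fls_nth (laurent_of_poly r / ?P) (1 + int t) \<noteq> 0"
    using nth_fls_subdegree_nonzero[of "laurent_of_poly r / ?P"] P R by simp
  have "laurent_of_poly (Polynomial.monom 1 t * g) / ?P =
      laurent_of_poly (Polynomial.monom 1 t) * (laurent_of_poly g / ?P)"
    by (simp add: laurent_of_poly_mult)
  \<comment> \<open>The polynomial part \<open>g div p\<close> has no coefficient at the index
    \<open>1 + t\<close>, so only \<open>r / p\<close> contributes.\<close>
  then have "fls_nth (laurent_of_poly (Polynomial.monom 1 t * g) / ?P) 1 \<noteq> 0"
    using nz by (simp add: laurent_of_poly_monom_times_nth quot laurent_of_poly_nth)
  moreover have "t < Polynomial.degree p" using deg by (simp add: t_def)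
  ultimately show ?thesis using that by blast
qed

section \<open>The additive character of the prime field\<close>

lemma to_int_mod_ring_bounds:
  fixes x :: "'p::finite mod_ring"
  shows "0 \<le> to_int_mod_ring x" "to_int_mod_ring x < int CARD('p)"
  using range_to_int_mod_ring[where 'a='p] by (metis atLeastLessThan_iff rangeI)+

lemma of_nat_to_int_mod_ring [simp]:
  fixes x :: "'p::nontriv mod_ring"
  shows "of_nat (nat (to_int_mod_ring x)) = x"
  using to_int_mod_ring_bounds[of x] by (simp add: of_nat_of_int_mod_ring o_def)

lemma nat_to_int_mod_ring_of_nat:
  "nat (to_int_mod_ring (of_nat n :: 'p::nontriv mod_ring)) = n mod CARD('p)"
proof -
  have "to_int_mod_ring (of_nat n :: 'p mod_ring) = int n mod int CARD('p)"
    by (simp add: of_nat_of_int_mod_ring o_def of_int_mod_ring.rep_eq to_int_mod_ring.rep_eq)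
  then show ?thesis by (simp add: nat_mod_as_int)
qed

definition mod_char :: "'p::prime_card mod_ring \<Rightarrow> complex" where
  "mod_char t = exp (2 * of_real pi * \<i> / of_nat CARD('p)) ^ nat (to_int_mod_ring t)"

lemma root_of_unity_power_eq_1_iff:
  "0 < n \<Longrightarrow> exp (2 * of_real pi * \<i> / of_nat n) ^ k = 1 \<longleftrightarrow> n dvd k"
  using complex_root_unity_eq_1[of n k] by (simp add: exp_of_nat_mult[symmetric] mult_ac)

text \<open>The base is a root of unity of order \<open>CARD('p)\<close>, so exponents matter only
  modulo \<open>CARD('p)\<close>. This translates the natural number exponents of \<open>wal\<close>
  into field elements.\<close>

lemma mod_char_of_nat:
  "mod_char (of_nat e :: 'p::prime_card mod_ring) = exp (2 * of_real pi * \<i> / of_nat CARD('p)) ^ e"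
proof -
  let ?w = "exp (2 * of_real pi * \<i> / of_nat CARD('p)) :: complex"
  have "?w ^ CARD('p) = 1" by (subst root_of_unity_power_eq_1_iff) auto
  then have "?w ^ (CARD('p) * (e div CARD('p)) + e mod CARD('p)) = ?w ^ (e mod CARD('p))"
    by (simp only: power_add power_mult) simp
  then show ?thesis by (simp add: mod_char_def nat_to_int_mod_ring_of_nat)
qed

lemma mod_char_0 [simp]: "mod_char 0 = 1"
  by (simp add: mod_char_def)

lemma mod_char_add:
  fixes s t :: "'p::prime_card mod_ring"
  shows "mod_char (s + t) = mod_char s * mod_char t"
proof -
  \<comment> \<open>The sum of the two representatives may exceed \<open>CARD('p)\<close>;
    \<open>mod_char_of_nat\<close> accepts it unreduced.\<close>
  have "mod_char (of_nat (nat (to_int_mod_ring s) + nat (to_int_mod_ring t)) :: 'p mod_ring) =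
      mod_char s * mod_char t"
    unfolding mod_char_of_nat by (simp add: mod_char_def power_add)
  then show ?thesis by simp
qed

lemma mod_char_sum: "mod_char (\<Sum>i\<in>A. f i) = (\<Prod>i\<in>A. mod_char (f i))"
  by (induction A rule: infinite_finite_induct) (simp_all add: mod_char_add)

lemma mod_char_eq_1_iff: "mod_char t = 1 \<longleftrightarrow> t = 0"
proof
  fix t :: "'p::prime_card mod_ring"
  assume "mod_char t = 1"
  then have "CARD('p) dvd nat (to_int_mod_ring t)"
    by (simp add: mod_char_def root_of_unity_power_eq_1_iff)
  moreover have "nat (to_int_mod_ring t) < CARD('p)"
    using to_int_mod_ring_bounds[of t] by simp
  ultimately have "nat (to_int_mod_ring t) = 0"
    using nat_dvd_not_less by blast
  then show "t = 0" by (metis of_nat_to_int_mod_ring of_nat_0)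
qed simp

lemma card_mod_ring_ge_2: "2 \<le> CARD('p::prime_card)"
  by (rule prime_ge_2_nat) (rule prime_card)

section \<open>Enumeration of polynomials and character sums over lattice points\<close>

lemma coeff_trunc_poly:
  "Polynomial.coeff (trunc_poly b m k) i = (if i < m then of_nat (nat_digit b k i) else 0)"
  by (simp add: trunc_poly_def coeff_sum)

lemma nat_poly_eq_trunc_poly:
  assumes "2 \<le> b" "n < b ^ m"
  shows "nat_poly b n = trunc_poly b m n"
proof (rule poly_eqI)
  fix i
  have "nat_digit b n i = 0" if "m \<le> i"
  proof -
    have "n < b ^ i" using assms that by (meson less_le_trans power_increasing one_le_numeral le_trans)
    then show ?thesis by (simp add: nat_digit_def)
  qed
  then show "Polynomial.coeff (nat_poly b n) i = Polynomial.coeff (trunc_poly b m n :: 'a mod_ring poly) i"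
    using assms by (auto simp: nat_poly_def coeff_trunc_poly nat_digit_eq_0)
qed

text \<open>This turns a sum over point indices into a sum over an additive group of polynomials.
  The inverse \<open>G\<close> reads the coefficients as base \<open>b\<close> digits.\<close>

lemma bij_betw_nat_poly:
  assumes b: "b = CARD('p::prime_card)"
  shows "bij_betw (nat_poly b) {..<b ^ m} {f :: 'p mod_ring poly. \<forall>i\<ge>m. Polynomial.coeff f i = 0}"
proof -
  have b2: "2 \<le> b" using card_mod_ring_ge_2 b by blast
  define G :: "'p mod_ring poly \<Rightarrow> nat" where
    "G = (\<lambda>f. \<Sum>i<m. nat (to_int_mod_ring (Polynomial.coeff f i)) * b ^ i)"
  have dig: "nat (to_int_mod_ring (x :: 'p mod_ring)) < b" for x
    using to_int_mod_ring_bounds[of x] b by simp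
  show ?thesis
  proof (rule bij_betw_byWitness[where f' = G])
    show "\<forall>n\<in>{..<b ^ m}. G (nat_poly b n) = n"
    proof
      fix n assume "n \<in> {..<b ^ m}"
      then have n: "n < b ^ m" by simp
      have "nat (to_int_mod_ring (of_nat (nat_digit b n i) :: 'p mod_ring)) = nat_digit b n i" for i
        using nat_digit_less[OF b2, of n i] b by (simp add: nat_to_int_mod_ring_of_nat)
      then show "G (nat_poly b n) = n"
        using sum_nat_digit[OF n] by (simp add: G_def nat_poly_eq_trunc_poly[OF b2 n] coeff_trunc_poly)
    qed
    have G_less: "G f < b ^ m" for f unfolding G_def by (rule sum_digits_less) (rule dig)
    show "\<forall>f\<in>{f. \<forall>i\<ge>m. Polynomial.coeff f i = 0}. nat_poly b (G f) = f"
    proof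
      fix f :: "'p mod_ring poly" assume f: "f \<in> {f. \<forall>i\<ge>m. Polynomial.coeff f i = 0}"
      have "nat_digit b (G f) i = (if i < m then nat (to_int_mod_ring (Polynomial.coeff f i)) else 0)" for i
        unfolding G_def by (rule nat_digit_sum) (rule dig)
      then show "nat_poly b (G f) = f"
        using f by (intro poly_eqI) (auto simp: nat_poly_eq_trunc_poly[OF b2 G_less] coeff_trunc_poly)
    qed
    show "nat_poly b ` {..<b ^ m} \<subseteq> {f :: 'p mod_ring poly. \<forall>i\<ge>m. Polynomial.coeff f i = 0}"
      by (auto simp: nat_poly_eq_trunc_poly[OF b2] coeff_trunc_poly)
    show "G ` {f. \<forall>i\<ge>m. Polynomial.coeff f i = 0} \<subseteq> {..<b ^ m}"
      using G_less by auto
  qed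
qed

lemma laurent_trunc_digits:
  fixes F :: "'p::prime_card mod_ring fls"
  assumes "b = CARD('p)"
  shows "real_digit b (laurent_trunc b m F) (Suc i) =
    (if i < m then nat (to_int_mod_ring (fls_nth F (int (Suc i)))) else 0)"
proof -
  let ?c = "\<lambda>i. nat (to_int_mod_ring (fls_nth F (int (Suc i))))"
  have "laurent_trunc b m F = (\<Sum>i<m. real (?c i) / real b ^ Suc i)"
    unfolding laurent_trunc_def
    by (rule sum.reindex_bij_witness[of _ Suc "\<lambda>r. r - 1"]) (auto simp: to_int_mod_ring_bounds)
  moreover have "?c i < b" for i
    using to_int_mod_ring_bounds[of "fls_nth F (int (Suc i))"] assms by simp
  moreover have "2 \<le> b" using card_mod_ring_ge_2 assms by blast
  ultimately show ?thesis by (simp only: real_digit_sum(3))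
qed

text \<open>The lattice points have at most \<open>m\<close> nonzero digits, so only the first
  \<open>m\<close> digits of each \<open>k j\<close> enter. Every Walsh factor is then the character
  of a residue; the product of characters becomes the character of the sum, from which the
  polynomial of \<open>n\<close> factors out.\<close>

lemma wal_vec_poly_lattice_point:
  fixes q :: "nat \<Rightarrow> 'p::prime_card mod_ring poly"
  assumes "b = CARD('p)"
  shows "wal_vec b t k (poly_lattice_point b m t q p n) =
    mod_char (fls_nth (laurent_of_poly (nat_poly b n * (\<Sum>j = 1..t. trunc_poly b m (k j) * q j))
      / laurent_of_poly p) 1)"
proof -
  let ?F = "\<lambda>j. laurent_of_poly (nat_poly b n * q j) / laurent_of_poly p"
  have b2: "2 \<le> b" using card_mod_ring_ge_2 assms by blast
  have wal: "wal b (k j) (laurent_trunc b m (?F j)) =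
      mod_char (fls_nth (laurent_of_poly (trunc_poly b m (k j)) * ?F j) 1)" for j
  proof -
    have "wal b (k j) (laurent_trunc b m (?F j)) = mod_char (of_nat
      (\<Sum>i<m. real_digit b (laurent_trunc b m (?F j)) (Suc i) * nat_digit b (k j) i) :: 'p mod_ring)"
      unfolding mod_char_of_nat assms[symmetric]
      by (rule wal_eq_power[OF b2]) (simp add: laurent_trunc_digits[OF assms])
    also have "(of_nat (\<Sum>i<m. real_digit b (laurent_trunc b m (?F j)) (Suc i) * nat_digit b (k j) i) :: 'p mod_ring)
        = fls_nth (laurent_of_poly (trunc_poly b m (k j)) * ?F j) 1"
      unfolding laurent_trunc_poly_times_nth
      by (simp add: laurent_trunc_digits[OF assms] mult.commute[of "of_nat _"] del: of_nat_Suc)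
    finally show ?thesis .
  qed
  have "wal_vec b t k (poly_lattice_point b m t q p n) =
      (\<Prod>j = 1..t. mod_char (fls_nth (laurent_of_poly (trunc_poly b m (k j)) * ?F j) 1))"
    by (simp add: wal_vec_def poly_lattice_point_def wal)
  also have "\<dots> = mod_char (fls_nth (\<Sum>j = 1..t. laurent_of_poly (trunc_poly b m (k j)) * ?F j) 1)"
    by (simp only: mod_char_sum[symmetric] fls_sum_nth)
  also have "(\<Sum>j = 1..t. laurent_of_poly (trunc_poly b m (k j)) * ?F j) =
      laurent_of_poly (nat_poly b n * (\<Sum>j = 1..t. trunc_poly b m (k j) * q j)) / laurent_of_poly p"
    by (simp add: laurent_of_poly_mult laurent_of_poly_sum sum_distrib_left sum_divide_distrib mult_ac)
  finally show ?thesis .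
qed

text \<open>Translation by an element on which the character is nontrivial multiplies the sum by a factor other than \<open>1\<close>.\<close>

lemma sum_character_eq_0:
  fixes \<phi> :: "'a::ab_group_add \<Rightarrow> 'p::prime_card mod_ring"
  assumes hom: "\<And>x y. \<phi> (x + y) = \<phi> x + \<phi> y"
    and closed: "\<And>x y. x \<in> V \<Longrightarrow> y \<in> V \<Longrightarrow> x + y \<in> V" "\<And>x y. x \<in> V \<Longrightarrow> y \<in> V \<Longrightarrow> x - y \<in> V"
    and z: "z \<in> V" "\<phi> z \<noteq> 0"
  shows "(\<Sum>x\<in>V. mod_char (\<phi> x)) = 0"
proof -
  have "(\<Sum>x\<in>V. mod_char (\<phi> x)) = (\<Sum>x\<in>V. mod_char (\<phi> (x + z)))"
    using closed z by (intro sum.reindex_bij_witness[of _ "\<lambda>x. x + z" "\<lambda>x. x - z"]) auto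
  also have "\<dots> = (\<Sum>x\<in>V. mod_char (\<phi> x)) * mod_char (\<phi> z)"
    by (simp add: hom mod_char_add sum_distrib_right)
  finally show ?thesis using z by (simp add: mod_char_eq_1_iff)
qed

text \<open>Off the dual lattice \<open>p\<close> does not divide \<open>g\<close>, so the residue
  of \<open>f * g / p\<close> is a nontrivial homomorphism in \<open>f\<close>, already on a
  monomial of degree less than \<open>m\<close>, and its character sum vanishes.\<close>

lemma sum_wal_vec_poly_lattice:
  fixes q :: "nat \<Rightarrow> 'p::prime_card mod_ring poly"
  assumes b: "b = CARD('p)" and p: "Polynomial.degree p = m" "p \<noteq> 0"
    and k: "k \<in> {1..t} \<rightarrow>\<^sub>E UNIV" "k \<notin> dual_lattice b m t q p"
  shows "(\<Sum>n<b ^ m. wal_vec b t k (poly_lattice_point b m t q p n)) = 0"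
proof -
  define g where "g = (\<Sum>j = 1..t. trunc_poly b m (k j) * q j)"
  let ?V = "{f :: 'p mod_ring poly. \<forall>i\<ge>m. Polynomial.coeff f i = 0}"
  define \<phi> where "\<phi> = (\<lambda>f. fls_nth (laurent_of_poly (f * g) / laurent_of_poly p) 1)"
  have "\<not> p dvd g" using k by (simp add: dual_lattice_def g_def)
  then obtain z where z: "z < m" "\<phi> (Polynomial.monom 1 z) \<noteq> 0"
    using residue_monom_times_nonzero[OF p(2)] p(1) unfolding \<phi>_def by metis
  have "(\<Sum>n<b ^ m. wal_vec b t k (poly_lattice_point b m t q p n)) =
      (\<Sum>n<b ^ m. mod_char (\<phi> (nat_poly b n)))"
    by (simp add: wal_vec_poly_lattice_point[OF b] \<phi>_def g_def)
  also have "\<dots> = (\<Sum>f\<in>?V. mod_char (\<phi> f))"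
    by (rule sum.reindex_bij_betw[OF bij_betw_nat_poly[OF b]])
  also have "\<dots> = 0"
  proof (rule sum_character_eq_0)
    show "\<phi> (x + y) = \<phi> x + \<phi> y" for x y
      by (simp add: \<phi>_def distrib_right laurent_of_poly_add add_divide_distrib)
    show "Polynomial.monom 1 z \<in> ?V" using z by auto
  qed (use z in auto)
  finally show ?thesis .
qed

section \<open>Weights of deinterlaced indices\<close>

text \<open>Among subsets of bounded size the largest elements have the largest sum. The induction
  removes the maximum of \<open>A\<close> and the maximum of \<open>D\<close> at the same
  time.\<close>

lemma sum_le_sum_list_take_rev_sorted:
  fixes D :: "nat set"
  assumes "finite D" "A \<subseteq> D" "card A \<le> \<alpha>"
  shows "\<Sum>A \<le> sum_list (take \<alpha> (rev (sorted_list_of_set D)))"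
  using assms
proof (induction \<alpha> arbitrary: A D)
  case 0
  then show ?case by (simp add: finite_subset)
next
  case (Suc \<alpha>)
  show ?case
  proof (cases "A = {}")
    case False
    have fin: "finite A" using Suc.prems finite_subset by blast
    have D: "D \<noteq> {}" using False Suc.prems by blast
    have "sorted_list_of_set D = sorted_list_of_set (D - {Max D}) @ [Max D]"
    proof (rule sorted_distinct_set_unique)
      show "sorted (sorted_list_of_set (D - {Max D}) @ [Max D])"
        using Suc.prems by (auto simp: sorted_append)
      show "distinct (sorted_list_of_set (D - {Max D}) @ [Max D])"
        using Suc.prems by auto
      show "set (sorted_list_of_set D) = set (sorted_list_of_set (D - {Max D}) @ [Max D])"
        using Suc.prems Max_in[OF Suc.prems(1) D] by auto
    qed auto
    then have "sum_list (take (Suc \<alpha>) (rev (sorted_list_of_set D))) =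
        Max D + sum_list (take \<alpha> (rev (sorted_list_of_set (D - {Max D}))))"
      by simp
    moreover have "\<Sum>(A - {Max A}) \<le> sum_list (take \<alpha> (rev (sorted_list_of_set (D - {Max D}))))"
    proof (rule Suc.IH)
      \<comment> \<open>If the maximum of \<open>D\<close> belongs to \<open>A\<close>, it is also
        the maximum of \<open>A\<close> and is removed with it; hence the inclusion survives the
        removal.\<close>
      have max: "Max D = Max A" if "Max D \<in> A"
        using Max_ge[OF fin that] Max_mono[OF Suc.prems(2) False Suc.prems(1)] by (rule antisym)
      show "A - {Max A} \<subseteq> D - {Max D}"
      proof
        fix x assume x: "x \<in> A - {Max A}"
        have "x \<noteq> Max D"
        proof
          assume "x = Max D"
          with x max show False by simp
        qed
        with x Suc.prems(2) show "x \<in> D - {Max D}" by blast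
      qed
      show "card (A - {Max A}) \<le> \<alpha>"
        using Suc.prems fin False by simp
    qed (use Suc.prems in simp)
    moreover have "\<Sum>A = Max A + \<Sum>(A - {Max A})"
      using fin False by (intro sum.remove) auto
    moreover have "Max A \<le> Max D"
      using Suc.prems False by (intro Max_mono)
    ultimately show ?thesis by linarith
  qed simp
qed

lemma mem_digit_positions_iff:
  assumes "2 \<le> b"
  shows "Suc i \<in> digit_positions b k \<longleftrightarrow> nat_digit b k i \<noteq> 0"
proof -
  have "Suc i \<le> k" if "nat_digit b k i \<noteq> 0"
    using nat_digit_eq_0[OF assms, of k i] that by linarith
  then show ?thesis by (auto simp: digit_positions_def)
qed

lemma finite_digit_positions [simp]: "finite (digit_positions b k)"
  by (simp add: digit_positions_def)

lemma mu_1_mem_digit_positions: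
  assumes b: "2 \<le> b" and "k \<noteq> 0"
  shows "mu b 1 k \<in> digit_positions b k"
proof -
  obtain i where "nat_digit b k i \<noteq> 0"
    using nat_digit_ext[OF b, of k 0] assms(2) by (auto simp: nat_digit_def)
  then have "digit_positions b k \<noteq> {}"
    using mem_digit_positions_iff[OF b] by blast
  then have ne: "rev (sorted_list_of_set (digit_positions b k)) \<noteq> []" by simp
  then have "mu b 1 k = hd (rev (sorted_list_of_set (digit_positions b k)))"
    unfolding mu_def by (cases "rev (sorted_list_of_set (digit_positions b k))") simp_all
  then show ?thesis using hd_in_set[OF ne] by simp
qed

text \<open>Digit \<open>i\<close> of a number survives as digit \<open>i div d\<close> of its part
  with index \<open>i mod d\<close>, so the parts determine all digits.\<close>

lemma deinterlace_eqD:
  assumes b: "2 \<le> b" and d: "0 < d" and eq: "\<And>r. r < d \<Longrightarrow> deinterlace b d r k = deinterlace b d r l"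
  shows "k = l"
proof (rule nat_digit_ext[OF b])
  fix i
  have "deinterlace b d (i mod d) k = deinterlace b d (i mod d) l" using d by (intro eq) simp
  then have "nat_digit b (deinterlace b d (i mod d) k) (i div d) =
      nat_digit b (deinterlace b d (i mod d) l) (i div d)" by simp
  then show "nat_digit b k i = nat_digit b l i"
    by (simp add: nat_digit_deinterlace[OF b d])
qed

lemma deinterlace_0 [simp]: "deinterlace b d r 0 = 0"
  by (simp add: deinterlace_def)

text \<open>For \<open>j = Suc (r + i * d)\<close> the ceiling is \<open>i + 1\<close>, and the
  terms with \<open>i\<close> cancel. The remaining exponent is the position, counted from 1, to
  which interlacing sends the leading digit of \<open>k\<close> in component
  \<open>r\<close>.\<close>

lemma r_tilde_eq:
  assumes b: "2 \<le> b" and "r < d" "k \<noteq> 0"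
  shows "r_tilde b d (Suc (r + i * d)) k = 1 / real b ^ Suc (r + (mu b 1 k - 1) * d)"
proof -
  have d: "0 < d" using assms by simp
  obtain a where a: "mu b 1 k = Suc a"
    using mu_1_mem_digit_positions[OF b assms(3)] by (cases "mu b 1 k") (auto simp: digit_positions_def)
  have "\<lceil>real (Suc (r + i * d)) / real d\<rceil> = int i + 1"
  proof (rule ceiling_unique)
    show "of_int (int i + 1) - 1 < real (Suc (r + i * d)) / real d"
      using d by (simp add: field_simps)
    have "real (Suc r) \<le> real d" using assms by simp
    then show "real (Suc (r + i * d)) / real d \<le> of_int (int i + 1)"
      using d by (simp add: field_simps)
  qed
  then have "- int d * int (mu b 1 k) - int (Suc (r + i * d)) + int d * \<lceil>real (Suc (r + i * d)) / real d\<rceil>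
      = - int (Suc (r + a * d))"
    unfolding a by (simp add: algebra_simps)
  then have "r_tilde b d (Suc (r + i * d)) k = real b powi (- int (Suc (r + a * d)))"
    using assms(3) by (simp only: r_tilde_def if_False)
  also have "\<dots> = 1 / real b ^ Suc (r + a * d)"
    by (simp only: power_int_minus power_int_of_nat inverse_eq_divide)
  finally show ?thesis unfolding a by simp
qed

lemma r_alpha_le_prod_r_tilde:
  assumes b: "2 \<le> b" and d: "0 < d" "d \<le> \<alpha>"
  shows "r_alpha b \<alpha> l \<le> (\<Prod>r<d. r_tilde b d (Suc (r + i * d)) (deinterlace b d r l))"
proof -
  define R where "R = {r. r < d \<and> deinterlace b d r l \<noteq> 0}"
  \<comment> \<open>\<open>pos r\<close> is the position in \<open>l\<close> of the leading digit of
    its part \<open>r\<close>.\<close>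
  define pos where "pos = (\<lambda>r. Suc (r + (mu b 1 (deinterlace b d r l) - 1) * d))"
  have R: "finite R" "R \<subseteq> {..<d}" by (auto simp: R_def)
  have "(\<Prod>r<d. r_tilde b d (Suc (r + i * d)) (deinterlace b d r l)) =
      (\<Prod>r\<in>R. r_tilde b d (Suc (r + i * d)) (deinterlace b d r l))"
    by (rule prod.mono_neutral_right) (auto simp: R_def r_tilde_def)
  also have "\<dots> = (\<Prod>r\<in>R. 1 / real b ^ pos r)"
    by (rule prod.cong) (auto simp: R_def pos_def r_tilde_eq[OF b])
  also have "\<dots> = 1 / real b ^ (\<Sum>r\<in>R. pos r)"
    by (simp add: prod_dividef power_sum)
  finally have eq: "(\<Prod>r<d. r_tilde b d (Suc (r + i * d)) (deinterlace b d r l)) =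
      1 / real b ^ (\<Sum>r\<in>R. pos r)" .
  \<comment> \<open>The residue of \<open>pos r - 1\<close> modulo \<open>d\<close> is
    \<open>r\<close>, so different parts have different leading positions.\<close>
  have "inj_on pos R"
  proof (rule inj_onI)
    fix x y assume xy: "x \<in> R" "y \<in> R" "pos x = pos y"
    then have "(x + (mu b 1 (deinterlace b d x l) - 1) * d) mod d =
        (y + (mu b 1 (deinterlace b d y l) - 1) * d) mod d" by (simp add: pos_def)
    then show "x = y" using xy by (simp add: R_def)
  qed
  then have "(\<Sum>r\<in>R. pos r) = \<Sum>(pos ` R)" by (simp add: sum.reindex)
  also have "\<dots> \<le> mu b \<alpha> l"
    unfolding mu_def
  proof (rule sum_le_sum_list_take_rev_sorted)
    show "pos ` R \<subseteq> digit_positions b l"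
    proof
      fix x assume "x \<in> pos ` R"
      then obtain r where r: "r < d" "deinterlace b d r l \<noteq> 0" "x = pos r" by (auto simp: R_def)
      from mu_1_mem_digit_positions[OF b r(2)]
      have "nat_digit b (deinterlace b d r l) (mu b 1 (deinterlace b d r l) - 1) \<noteq> 0"
        by (simp add: digit_positions_def)
      then show "x \<in> digit_positions b l"
        unfolding r(3) pos_def mem_digit_positions_iff[OF b] nat_digit_deinterlace[OF b d(1)] .
    qed
    have "card (pos ` R) \<le> card R" by (rule card_image_le) (rule R)
    also have "\<dots> \<le> d" using card_mono[OF _ R(2)] by simp
    finally show "card (pos ` R) \<le> \<alpha>" using d by simp
  qed simp
  finally show ?thesis
    unfolding eq r_alpha_def using b by (intro divide_left_mono power_increasing) auto
qed

section \<open>From single blocks to index vectors\<close>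

lemma deinterlace_vec_block:
  assumes "i < s" "r < d"
  shows "deinterlace_vec b d s l (Suc (r + i * d)) = deinterlace b d r (l (Suc i))"
  using block_index_less[OF assms] assms by (simp add: deinterlace_vec_def Suc_le_eq)

lemma deinterlace_vec_PiE: "deinterlace_vec b d s l \<in> {1..d * s} \<rightarrow>\<^sub>E UNIV"
  by (simp add: deinterlace_vec_def)

lemma inj_on_deinterlace_vec:
  assumes "2 \<le> b" "0 < d"
  shows "inj_on (deinterlace_vec b d s) ({1..s} \<rightarrow>\<^sub>E UNIV)"
proof (rule inj_onI)
  fix k l assume kl: "k \<in> {1..s} \<rightarrow>\<^sub>E UNIV" "l \<in> {1..s} \<rightarrow>\<^sub>E UNIV"
    "deinterlace_vec b d s k = deinterlace_vec b d s l"
  show "k = l"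
  proof (rule PiE_ext[OF kl(1,2)])
    fix j assume "j \<in> {1..s}"
    then obtain i where i: "j = Suc i" "i < s" by (cases j) auto
    show "k j = l j"
    proof (rule deinterlace_eqD[OF assms])
      fix r assume "r < d"
      then show "deinterlace b d r (k j) = deinterlace b d r (l j)"
        using fun_cong[OF kl(3), of "Suc (r + i * d)"] i by (simp add: deinterlace_vec_block)
    qed
  qed
qed

lemma prod_r_alpha_le_prod_r_tilde:
  assumes "2 \<le> b" "0 < d" "d \<le> \<alpha>"
  shows "(\<Prod>j = 1..s. r_alpha b \<alpha> (l j)) \<le> (\<Prod>j = 1..d * s. r_tilde b d j (deinterlace_vec b d s l j))"
proof -
  have "(\<Prod>j = 1..s. r_alpha b \<alpha> (l j)) = (\<Prod>i<s. r_alpha b \<alpha> (l (Suc i)))"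
    by (rule prod_atLeastAtMost_1_eq)
  also have "\<dots> \<le> (\<Prod>i<s. \<Prod>r<d. r_tilde b d (Suc (r + i * d)) (deinterlace b d r (l (Suc i))))"
    by (intro prod_mono conjI r_alpha_le_prod_r_tilde assms) (simp add: r_alpha_def)
  also have "\<dots> = (\<Prod>i<s. \<Prod>r<d. r_tilde b d (Suc (r + i * d)) (deinterlace_vec b d s l (Suc (r + i * d))))"
    by (intro prod.cong refl) (simp add: deinterlace_vec_block)
  also have "\<dots> = (\<Prod>i<s * d. r_tilde b d (Suc i) (deinterlace_vec b d s l (Suc i)))"
    by (rule prod_nat_blocks[symmetric])
  also have "\<dots> = (\<Prod>j = 1..d * s. r_tilde b d j (deinterlace_vec b d s l j))"
    by (simp only: prod_atLeastAtMost_1_eq mult.commute)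
  finally show ?thesis .
qed

text \<open>A number is nonzero exactly when one of its \<open>d\<close> parts is. Hence the weight
  attached to the support of the deinterlaced vector is the weight attached to the support of
  \<open>l\<close>.\<close>

lemma block_support_deinterlace_vec:
  assumes "2 \<le> b" "0 < d"
  shows "block_support d s {j \<in> {1..d * s}. deinterlace_vec b d s l j \<noteq> 0} = {j \<in> {1..s}. l j \<noteq> 0}"
proof -
  let ?u = "{j \<in> {1..d * s}. deinterlace_vec b d s l j \<noteq> 0}"
  have block: "Suc i \<in> block_support d s ?u \<longleftrightarrow> l (Suc i) \<noteq> 0" if i: "i < s" for i
  proof
    assume "Suc i \<in> block_support d s ?u"
    then have "?u \<inter> {i * d + 1..Suc i * d} \<noteq> {}"
      unfolding block_support_def by simp
    then obtain x where x: "x \<in> ?u" "x \<in> {i * d + 1..Suc i * d}"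
      by fast
    define r where "r = x - 1 - i * d"
    have r: "r < d" "x = Suc (r + i * d)" using x(2) by (auto simp: r_def)
    have "deinterlace b d r (l (Suc i)) \<noteq> 0"
      using x(1) unfolding r(2) deinterlace_vec_block[OF i r(1), symmetric] by simp
    then show "l (Suc i) \<noteq> 0" by (metis deinterlace_0)
  next
    assume "l (Suc i) \<noteq> 0"
    then obtain r where r: "r < d" "deinterlace b d r (l (Suc i)) \<noteq> 0"
      using deinterlace_eqD[OF assms, of "l (Suc i)" 0] by auto
    then have "Suc (r + i * d) \<in> ?u"
      using block_index_less[OF i r(1)] by (simp add: deinterlace_vec_block[OF i] Suc_le_eq)
    moreover have "Suc (r + i * d) \<in> {i * d + 1..Suc i * d}" using r by simp
    ultimately have "?u \<inter> {i * d + 1..Suc i * d} \<noteq> {}" by fast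
    then show "Suc i \<in> block_support d s ?u"
      using i by (simp add: block_support_def)
  qed
  show ?thesis
  proof (rule Set.set_eqI)
    fix j
    show "j \<in> block_support d s ?u \<longleftrightarrow> j \<in> {j \<in> {1..s}. l j \<noteq> 0}"
    proof (cases "j \<in> {1..s}")
      case True
      then obtain i where "j = Suc i" "i < s" by (cases j) auto
      then show ?thesis using block[of i] by simp
    qed (auto simp: block_support_def)
  qed
qed

section \<open>Walsh coefficients and bounds for infinite sums\<close>

lemma wal_vec_0: "wal_vec b s (\<lambda>j\<in>{1..s}. 0) x = 1"
  by (simp add: wal_vec_def wal_def)

lemma norm_wal_vec [simp]: "norm (wal_vec b s k x) = 1"
proof -
  have "norm (exp (2 * of_real pi * \<i> / of_nat b) :: complex) = 1" by (simp add: norm_exp_eq_Re)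
  then show ?thesis by (simp add: wal_vec_def wal_def prod_norm[symmetric] norm_power)
qed

text \<open>Finite partial sums come arbitrarily close to \<open>a\<close>, and the triangle
  inequality bounds each of them by \<open>R\<close>; an infinite \<open>R\<close> is
  trivial.\<close>

lemma ennreal_norm_has_sum_le:
  fixes g :: "'a \<Rightarrow> 'b::real_normed_vector"
  assumes "(g has_sum a) S"
    and bound: "\<And>F. finite F \<Longrightarrow> F \<subseteq> S \<Longrightarrow> (\<Sum>x\<in>F. ennreal (norm (g x))) \<le> R"
  shows "ennreal (norm a) \<le> R"
proof (cases R rule: ennreal_cases)
  case (real B)
  have "norm a \<le> B + \<epsilon>" if \<epsilon>: "\<epsilon> > 0" for \<epsilon>
  proof -
    obtain F where F: "finite F" "F \<subseteq> S" "dist (sum g F) a \<le> \<epsilon>"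
      using has_sum_finite_approximation[OF assms(1) \<epsilon>] by blast
    have "(\<Sum>x\<in>F. norm (g x)) \<le> B"
      using bound[OF F(1,2)] real by (simp add: sum_ennreal)
    then have "norm (sum g F) \<le> B"
      using norm_sum order_trans by blast
    moreover have "norm a \<le> norm (sum g F) + dist (sum g F) a"
      by (metis dist_commute dist_norm norm_triangle_sub)
    ultimately show ?thesis using F(3) by linarith
  qed
  then have "norm a \<le> B" by (rule field_le_epsilon)
  then show ?thesis using real by (simp add: ennreal_leI)
qed simp

lemma sum_le_infsum_ennreal:
  fixes h :: "'a \<Rightarrow> ennreal"
  assumes "finite F" "F \<subseteq> A"
  shows "sum h F \<le> infsum h A"
  using assms by (subst nonneg_infsum_complete) (auto intro: SUP_upper)

text \<open>The coefficient occurs in the norm at the support \<open>v\<close> of \<open>l\<close>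
  with the inner index \<open>restrict l v\<close>, so the norm bound can be solved for it.\<close>

lemma walsh_coeff_bound:
  assumes b: "0 < b"
    and f: "f \<in> walsh_space b s \<alpha> \<gamma>" "walsh_norm b s \<alpha> \<gamma> f \<le> 1"
    and \<gamma>: "\<And>v. v \<subseteq> {1..s} \<Longrightarrow> 0 \<le> \<gamma> v"
    and l: "l \<in> {1..s} \<rightarrow>\<^sub>E UNIV"
  defines "v \<equiv> {j \<in> {1..s}. l j \<noteq> 0}"
  assumes v: "v \<noteq> {}"
  shows "norm (walsh_coeff b s f l) \<le> \<gamma> v * (\<Prod>j = 1..s. r_alpha b \<alpha> (l j))"
proof -
  have ext: "zero_extend {1..s} v (restrict l v) = l"
  proof
    fix j
    show "zero_extend {1..s} v (restrict l v) j = l j"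
      using PiE_arb[OF l, of j] by (simp add: zero_extend_def v_def)
  qed
  have mem: "restrict l v \<in> v \<rightarrow>\<^sub>E {1..}" by (auto simp: v_def)
  have vs: "v \<subseteq> {1..s}" by (auto simp: v_def)
  show ?thesis
  proof (cases "\<gamma> v = 0")
    case True
    \<comment> \<open>The norm ignores weight zero; as \<open>v\<close> is nonempty, membership in
      the space makes the coefficient vanish.\<close>
    then have "walsh_coeff b s f (zero_extend {1..s} v (restrict l v)) = 0"
      using f(1) vs v mem unfolding walsh_space_def by blast
    then show ?thesis unfolding ext using True by simp
  next
    case False
    then have pos: "0 < \<gamma> v" using \<gamma>[OF vs] by simp
    let ?c = "norm (walsh_coeff b s f l)" and ?r = "\<Prod>j\<in>v. r_alpha b \<alpha> (l j)"
    have r: "0 < ?r" using b by (intro prod_pos) (simp add: r_alpha_def)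
    let ?S = "\<lambda>v. SUP l\<in>v \<rightarrow>\<^sub>E {1..}. ennreal (norm (walsh_coeff b s f (zero_extend {1..s} v l)) /
        (\<Prod>j\<in>v. r_alpha b \<alpha> (l j)))"
    have "(\<Prod>j\<in>v. r_alpha b \<alpha> (restrict l v j)) = ?r" by simp
    then have "ennreal (?c / ?r) =
        ennreal (norm (walsh_coeff b s f (zero_extend {1..s} v (restrict l v))) /
          (\<Prod>j\<in>v. r_alpha b \<alpha> (restrict l v j)))"
      by (simp only: ext)
    also have "\<dots> \<le> ?S v"
      by (rule SUP_upper[OF mem])
    finally have "ennreal (1 / \<gamma> v) * ennreal (?c / ?r) \<le> ennreal (1 / \<gamma> v) * ?S v"
      by (rule mult_left_mono) simp
    also have "\<dots> \<le> walsh_norm b s \<alpha> \<gamma> f"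
      unfolding walsh_norm_def
      by (rule SUP_upper[where f = "\<lambda>v. ennreal (1 / \<gamma> v) * ?S v"]) (use vs False in simp)
    finally have "ennreal (1 / \<gamma> v) * ennreal (?c / ?r) \<le> walsh_norm b s \<alpha> \<gamma> f" .
    then have "ennreal (1 / \<gamma> v) * ennreal (?c / ?r) \<le> 1"
      using f(2) by (rule order_trans)
    also have "ennreal (1 / \<gamma> v) * ennreal (?c / ?r) = ennreal (1 / \<gamma> v * (?c / ?r))"
      using pos r by (intro ennreal_mult[symmetric]) simp_all
    finally have "ennreal (1 / \<gamma> v * (?c / ?r)) \<le> 1" .
    then have "1 / \<gamma> v * (?c / ?r) \<le> 1" by (simp only: ennreal_le_1)
    then have "?c \<le> \<gamma> v * ?r" using pos r by (simp add: field_simps)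
    \<comment> \<open>Components outside \<open>v\<close> are 0 and have \<open>r_alpha\<close>
      equal to 1, as \<open>mu\<close> of 0 is an empty sum.\<close>
    also have "?r = (\<Prod>j = 1..s. r_alpha b \<alpha> (l j))"
      by (rule prod.mono_neutral_left) (auto simp: v_def r_alpha_def mu_def digit_positions_def)
    finally show ?thesis .
  qed
qed

section \<open>Worst-case error\<close>

lemma poly_lattice_point_digit_eq_0:
  fixes q :: "nat \<Rightarrow> 'p::prime_card mod_ring poly"
  assumes "b = CARD('p)" "j \<in> {1..t}" "m \<le> a"
  shows "real_digit b (poly_lattice_point b m t q p n j) (Suc a) = 0"
  using assms by (simp add: poly_lattice_point_def laurent_trunc_digits)

lemma interlaced_lattice_point_in_cube:
  fixes q :: "nat \<Rightarrow> 'p::prime_card mod_ring poly"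
  assumes "b = CARD('p)" "0 < d"
  shows "interlaced_lattice_point b m d s q p n \<in> {1..s} \<rightarrow>\<^sub>E {0..<1}"
proof -
  have block: "interlace b d (\<lambda>r. poly_lattice_point b m (d * s) q p n (i * d + r)) \<in> {0..<1}"
    if "i < s" for i
  proof (rule interlace_digits(1))
    show "2 \<le> b" using card_mod_ring_ge_2 assms by blast
    fix r a assume "r < d" "m \<le> a"
    then show "real_digit b (poly_lattice_point b m (d * s) q p n (i * d + Suc r)) (Suc a) = 0"
      using block_index_less[OF that, of r d] assms(1)
      by (intro poly_lattice_point_digit_eq_0) auto
  qed (rule assms)
  show ?thesis
    unfolding interlaced_lattice_point_def interlace_vec_def restrict_PiE_iff
  proof
    fix j assume "j \<in> {1..s}"
    then have "j - 1 < s" by auto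
    then show "interlace b d (\<lambda>r. poly_lattice_point b m (d * s) q p n ((j - 1) * d + r)) \<in> {0..<1}"
      by (rule block)
  qed
qed

text \<open>Averaging the Walsh series over the points keeps the index 0 term equal to the integral,
  because the Walsh function of index 0 is constantly 1. Removing this term leaves the
  error.\<close>

lemma cubature_error_has_sum:
  assumes f: "f \<in> walsh_space b s \<alpha> \<gamma>" and N: "0 < N"
    and P: "\<And>n. n < N \<Longrightarrow> P n \<in> {1..s} \<rightarrow>\<^sub>E {0..<1}"
  shows "((\<lambda>l. walsh_coeff b s f l * ((\<Sum>n<N. wal_vec b s l (P n)) / of_nat N))
    has_sum of_real ((\<Sum>n<N. f (P n)) / real N - (LINT x|cube s. f x)))
    (({1..s} \<rightarrow>\<^sub>E UNIV) - {\<lambda>j\<in>{1..s}. 0})"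
proof -
  let ?L = "{1..s} \<rightarrow>\<^sub>E (UNIV :: nat set)"
  let ?z = "\<lambda>j\<in>{1..s}. 0 :: nat"
  let ?g = "\<lambda>l. walsh_coeff b s f l * ((\<Sum>n<N. wal_vec b s l (P n)) / of_nat N)"
  have pt: "((\<lambda>l. walsh_coeff b s f l * wal_vec b s l (P n)) has_sum of_real (f (P n))) ?L"
    if "n < N" for n
  proof -
    have "\<forall>x\<in>{1..s} \<rightarrow>\<^sub>E {0..<1}.
        ((\<lambda>l. walsh_coeff b s f l * wal_vec b s l x) has_sum of_real (f x)) ?L"
      using f unfolding walsh_space_def by simp
    then show ?thesis using P[OF that] by (rule bspec)
  qed
  have "((\<lambda>l. \<Sum>n<k. walsh_coeff b s f l * wal_vec b s l (P n)) has_sum (\<Sum>n<k. of_real (f (P n)))) ?L"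
    if "k \<le> N" for k
    using that
  proof (induction k)
    case (Suc k)
    then show ?case
      using has_sum_add[OF Suc.IH pt[of k]] by simp
  qed simp
  from has_sum_cmult_left[OF this[OF order_refl], of "1 / of_nat N"]
  have all: "(?g has_sum (\<Sum>n<N. of_real (f (P n))) / of_nat N) ?L"
    by (simp only: sum_distrib_left[symmetric] mult.assoc times_divide_eq_right mult_1_right)
  have "walsh_coeff b s f ?z = of_real (LINT x|cube s. f x)"
    by (simp only: walsh_coeff_def wal_vec_0 complex_cnj_one mult_1_right integral_complex_of_real)
  moreover have "(\<Sum>n<N. wal_vec b s ?z (P n)) / of_nat N = 1"
    using N by (simp only: wal_vec_0) simp
  ultimately have "sum ?g {?z} = of_real (LINT x|cube s. f x)" by simp
  then have "(?g has_sum of_real (LINT x|cube s. f x)) {?z}"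
    using has_sum_finite[of "{?z}" ?g] by simp
  moreover have "{?z} \<subseteq> ?L" by (simp add: restrict_PiE_iff)
  ultimately have "(?g has_sum (\<Sum>n<N. of_real (f (P n))) / of_nat N - of_real (LINT x|cube s. f x)) (?L - {?z})"
    by (rule has_sum_Diff[OF all])
  then show ?thesis by (simp only: of_real_diff of_real_divide of_real_sum of_real_of_nat_eq)
qed

lemma support_nonempty:
  assumes "l \<in> I \<rightarrow>\<^sub>E UNIV" "l \<noteq> (\<lambda>j\<in>I. 0)"
  shows "{j \<in> I. l j \<noteq> 0} \<noteq> {}"
proof
  assume *: "{j \<in> I. l j \<noteq> 0} = {}"
  have "l = (\<lambda>j\<in>I. 0)"
  proof
    fix j
    show "l j = (\<lambda>j\<in>I. 0) j"
      using * PiE_arb[OF assms(1), of j] by (cases "j \<in> I") auto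
  qed
  with assms(2) show False ..
qed

text \<open>The indices \<open>l\<close> are grouped by the support \<open>u\<close> of their
  deinterlaced vectors. Within a group, restriction to \<open>u\<close> is injective into the index
  set of the inner sum, so the group is bounded by that infinite sum.\<close>

lemma sum_over_dual_lattice_le:
  fixes q :: "nat \<Rightarrow> 'p::prime_card mod_ring poly"
  assumes b: "2 \<le> b" and d: "0 < d" "d \<le> \<alpha>"
    and \<gamma>: "\<And>v. v \<subseteq> {1..s} \<Longrightarrow> 0 \<le> \<gamma> v"
    and F: "finite F" "F \<subseteq> ({1..s} \<rightarrow>\<^sub>E UNIV) - {\<lambda>j\<in>{1..s}. 0}"
    and dual: "\<And>l. l \<in> F \<Longrightarrow> deinterlace_vec b d s l \<in> dual_lattice b m (d * s) q p"
  shows "(\<Sum>l\<in>F. ennreal (\<gamma> {j \<in> {1..s}. l j \<noteq> 0} * (\<Prod>j = 1..s. r_alpha b \<alpha> (l j))))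
    \<le> (\<Sum>u\<in>{u. u \<subseteq> {1..d * s} \<and> u \<noteq> {}}. ennreal (\<gamma> (block_support d s u)) *
        (\<Sum>\<^sub>\<infinity>k\<in>{k \<in> u \<rightarrow>\<^sub>E {1..}. zero_extend {1..d * s} u k \<in> dual_lattice b m (d * s) q p}.
          ennreal (r_tilde_vec b d u k)))"
proof -
  define T where "T = deinterlace_vec b d s"
  define U where "U = (\<lambda>l. {j \<in> {1..d * s}. T l j \<noteq> 0})"
  let ?K = "\<lambda>u. {k \<in> u \<rightarrow>\<^sub>E {1..}. zero_extend {1..d * s} u k \<in> dual_lattice b m (d * s) q p}"
  let ?PP = "{u. u \<subseteq> {1..d * s} \<and> u \<noteq> {}}"
  have T_out: "T l j = undefined" if "j \<notin> {1..d * s}" for l j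
    unfolding T_def by (rule PiE_arb[OF deinterlace_vec_PiE that])
  have inj: "inj_on T F"
    unfolding T_def
    by (rule inj_on_subset[OF inj_on_deinterlace_vec[OF b d(1)] order_trans[OF F(2) Diff_subset]])
  have support: "block_support d s (U l) = {j \<in> {1..s}. l j \<noteq> 0}" for l
    unfolding U_def T_def by (rule block_support_deinterlace_vec[OF b d(1)])
  \<comment> \<open>Restriction to the support loses nothing: off \<open>U l\<close> the vector is
    0, and outside \<open>{1..d * s}\<close> both sides are \<open>undefined\<close>. Injectivity
    and membership in the dual lattice both rest on this.\<close>
  have ext: "zero_extend {1..d * s} (U l) (restrict (T l) (U l)) = T l" for l
  proof
    fix j
    show "zero_extend {1..d * s} (U l) (restrict (T l) (U l)) j = T l j"
    proof (cases "j \<in> {1..d * s}")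
      case True
      then show ?thesis by (simp add: zero_extend_def U_def)
    next
      case False
      then show ?thesis unfolding zero_extend_def restrict_def T_out[OF False] by (simp only: if_False)
    qed
  qed
  have "U l \<in> ?PP" if "l \<in> F" for l
  proof -
    have "block_support d s (U l) \<noteq> {}"
      unfolding support by (rule support_nonempty) (use F(2) that in blast)+
    then have "U l \<noteq> {}" unfolding block_support_def by force
    moreover have "U l \<subseteq> {1..d * s}" unfolding U_def by blast
    ultimately show ?thesis by simp
  qed
  then have U_PP: "U ` F \<subseteq> ?PP" by (rule image_subsetI)
  have fin_PP: "finite ?PP" by (rule finite_subset[of _ "Pow {1..d * s}"]) auto
  have "(\<Sum>l\<in>F. ennreal (\<gamma> {j \<in> {1..s}. l j \<noteq> 0} * (\<Prod>j = 1..s. r_alpha b \<alpha> (l j)))) \<le>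
      (\<Sum>l\<in>F. ennreal (\<gamma> (block_support d s (U l))) * ennreal (r_tilde_vec b d (U l) (restrict (T l) (U l))))"
  proof (rule sum_mono)
    fix l
    have "(\<Prod>j = 1..s. r_alpha b \<alpha> (l j)) \<le> (\<Prod>j = 1..d * s. r_tilde b d j (T l j))"
      unfolding T_def by (rule prod_r_alpha_le_prod_r_tilde[OF b d])
    also have "\<dots> = r_tilde_vec b d (U l) (T l)"
      unfolding r_tilde_vec_def by (rule prod.mono_neutral_right) (auto simp: U_def r_tilde_def)
    also have "\<dots> = r_tilde_vec b d (U l) (restrict (T l) (U l))"
      by (simp add: r_tilde_vec_def)
    finally have "\<gamma> {j \<in> {1..s}. l j \<noteq> 0} * (\<Prod>j = 1..s. r_alpha b \<alpha> (l j)) \<le>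
        \<gamma> (block_support d s (U l)) * r_tilde_vec b d (U l) (restrict (T l) (U l))"
      unfolding support by (rule mult_left_mono) (rule \<gamma>, blast)
    moreover have "0 \<le> \<gamma> (block_support d s (U l))" unfolding support by (rule \<gamma>) blast
    ultimately show "ennreal (\<gamma> {j \<in> {1..s}. l j \<noteq> 0} * (\<Prod>j = 1..s. r_alpha b \<alpha> (l j))) \<le>
        ennreal (\<gamma> (block_support d s (U l))) * ennreal (r_tilde_vec b d (U l) (restrict (T l) (U l)))"
      by (simp only: ennreal_mult'[symmetric] ennreal_leI)
  qed
  also have "\<dots> = (\<Sum>u\<in>?PP. \<Sum>l\<in>{l \<in> F. U l = u}.
      ennreal (\<gamma> (block_support d s (U l))) * ennreal (r_tilde_vec b d (U l) (restrict (T l) (U l))))"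
    by (simp only: sum.group[OF F(1) fin_PP U_PP])
  also have "\<dots> \<le> (\<Sum>u\<in>?PP. ennreal (\<gamma> (block_support d s u)) *
      (\<Sum>\<^sub>\<infinity>k\<in>?K u. ennreal (r_tilde_vec b d u k)))"
  proof (rule sum_mono)
    fix u
    let ?Fu = "{l \<in> F. U l = u}"
    have inj_u: "inj_on (\<lambda>l. restrict (T l) u) ?Fu"
    proof (rule inj_onI)
      fix k l assume kl: "k \<in> ?Fu" "l \<in> ?Fu" "restrict (T k) u = restrict (T l) u"
      have "zero_extend {1..d * s} u (restrict (T k) u) = zero_extend {1..d * s} u (restrict (T l) u)"
        by (simp only: kl(3))
      moreover have "zero_extend {1..d * s} u (restrict (T k) u) = T k"
        using ext[of k] kl(1) by (simp only: mem_Collect_eq)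
      moreover have "zero_extend {1..d * s} u (restrict (T l) u) = T l"
        using ext[of l] kl(2) by (simp only: mem_Collect_eq)
      ultimately have "T k = T l" by (simp only:)
      then show "k = l" by (rule inj_onD[OF inj]) (use kl(1,2) in blast)+
    qed
    have sub: "(\<lambda>l. restrict (T l) u) ` ?Fu \<subseteq> ?K u"
    proof
      fix k assume "k \<in> (\<lambda>l. restrict (T l) u) ` ?Fu"
      then obtain l where l: "l \<in> F" "U l = u" "k = restrict (T l) u" by blast
      have "zero_extend {1..d * s} u k = T l"
        using ext[of l] unfolding l(2,3) .
      then have dual_k: "zero_extend {1..d * s} u k \<in> dual_lattice b m (d * s) q p"
        using dual[OF l(1)] unfolding T_def by (simp only:)
      have "T l j \<in> {1..}" if "j \<in> U l" for j
        using that by (simp add: U_def)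
      then have "k \<in> u \<rightarrow>\<^sub>E {1..}"
        unfolding l(3) restrict_PiE_iff l(2) by blast
      then show "k \<in> ?K u" using dual_k by (intro CollectI conjI)
    qed
    have "(\<Sum>l\<in>?Fu. ennreal (r_tilde_vec b d u (restrict (T l) u))) =
        (\<Sum>k\<in>(\<lambda>l. restrict (T l) u) ` ?Fu. ennreal (r_tilde_vec b d u k))"
      by (simp only: sum.reindex[OF inj_u] o_def)
    also have "\<dots> \<le> (\<Sum>\<^sub>\<infinity>k\<in>?K u. ennreal (r_tilde_vec b d u k))"
      by (rule sum_le_infsum_ennreal[OF _ sub]) (simp add: F(1))
    finally have le: "(\<Sum>l\<in>?Fu. ennreal (r_tilde_vec b d u (restrict (T l) u))) \<le>
        (\<Sum>\<^sub>\<infinity>k\<in>?K u. ennreal (r_tilde_vec b d u k))" .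
    have "(\<Sum>l\<in>?Fu. ennreal (\<gamma> (block_support d s (U l))) *
        ennreal (r_tilde_vec b d (U l) (restrict (T l) (U l)))) =
      ennreal (\<gamma> (block_support d s u)) * (\<Sum>l\<in>?Fu. ennreal (r_tilde_vec b d u (restrict (T l) u)))"
      unfolding sum_distrib_left by (intro sum.cong refl) (simp only: mem_Collect_eq)
    also have "\<dots> \<le> ennreal (\<gamma> (block_support d s u)) * (\<Sum>\<^sub>\<infinity>k\<in>?K u. ennreal (r_tilde_vec b d u k))"
      by (rule mult_left_mono[OF le]) simp
    finally show "(\<Sum>l\<in>?Fu. ennreal (\<gamma> (block_support d s (U l))) *
        ennreal (r_tilde_vec b d (U l) (restrict (T l) (U l)))) \<le>
      ennreal (\<gamma> (block_support d s u)) * (\<Sum>\<^sub>\<infinity>k\<in>?K u. ennreal (r_tilde_vec b d u k))" .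
  qed
  finally show ?thesis .
qed

theorem theorem3:
  fixes b m s d \<alpha> :: nat
    and \<gamma> :: "nat set \<Rightarrow> real"
    and p :: "'p::prime_card mod_ring poly"
    and q :: "nat \<Rightarrow> 'p mod_ring poly"
  assumes "prime b" and "b = CARD('p)"
    and "1 \<le> m" and "1 \<le> s" and "1 < d" and "1 < \<alpha>"
    and "\<And>v. v \<subseteq> {1..s} \<Longrightarrow> 0 \<le> \<gamma> v"
    and "Polynomial.degree p = m"
    and "d \<le> \<alpha>"
  shows "worst_case_error b s \<alpha> \<gamma> (b ^ m) (interlaced_lattice_point b m d s q p)
    \<le> (\<Sum>u\<in>{u. u \<subseteq> {1..d * s} \<and> u \<noteq> {}}. ennreal (\<gamma> (block_support d s u)) *
        (\<Sum>\<^sub>\<infinity>k\<in>{k \<in> u \<rightarrow>\<^sub>E {1..}. zero_extend {1..d * s} u k \<in> dual_lattice b m (d * s) q p}.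
          ennreal (r_tilde_vec b d u k)))"
    (is "_ \<le> ?R")
proof -
  have b: "2 \<le> b" using card_mod_ring_ge_2 assms(2) by blast
  have d: "0 < d" using assms(5) by simp
  \<comment> \<open>The zero polynomial has degree 0, while \<open>m\<close> is at least 1.\<close>
  have p: "p \<noteq> 0" using assms(3,8) by auto
  have N: "0 < b ^ m" using b by simp
  let ?P = "interlaced_lattice_point b m d s q p"
  let ?D = "dual_lattice b m (d * s) q p"
  define avg where "avg = (\<lambda>l. (\<Sum>n<b ^ m. wal_vec b s l (?P n)) / of_nat (b ^ m))"
  have avg_le: "norm (avg l) \<le> 1" for l
  proof -
    have "norm (\<Sum>n<b ^ m. wal_vec b s l (?P n)) \<le> (\<Sum>n<b ^ m. norm (wal_vec b s l (?P n)))"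
      by (rule norm_sum)
    then show ?thesis using N by (simp add: avg_def norm_divide norm_power divide_le_eq)
  qed
  \<comment> \<open>The Walsh function of \<open>l\<close> on the interlaced points is that of the
    deinterlaced index on the lattice points, where the character sum applies.\<close>
  have avg_0: "avg l = 0" if "deinterlace_vec b d s l \<notin> ?D" for l
  proof -
    have "wal_vec b s l (?P n) = wal_vec b (d * s) (deinterlace_vec b d s l)
        (poly_lattice_point b m (d * s) q p n)" for n
      unfolding interlaced_lattice_point_def
      by (rule wal_vec_interlace_vec[OF b d]) (rule poly_lattice_point_digit_eq_0[OF assms(2)])
    then show ?thesis
      using sum_wal_vec_poly_lattice[OF assms(2,8) p deinterlace_vec_PiE that] by (simp add: avg_def)
  qed
  have "ennreal \<bar>(\<Sum>n<b ^ m. f (?P n)) / real (b ^ m) - (LINT x|cube s. f x)\<bar> \<le> ?R"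
    if f: "f \<in> walsh_space b s \<alpha> \<gamma>" "walsh_norm b s \<alpha> \<gamma> f \<le> 1" for f
  proof -
    have "((\<lambda>l. walsh_coeff b s f l * avg l)
        has_sum of_real ((\<Sum>n<b ^ m. f (?P n)) / real (b ^ m) - (LINT x|cube s. f x)))
        (({1..s} \<rightarrow>\<^sub>E UNIV) - {\<lambda>j\<in>{1..s}. 0})"
      unfolding avg_def
      by (rule cubature_error_has_sum[OF f(1) N interlaced_lattice_point_in_cube[OF assms(2) d]])
    then have "ennreal (norm (complex_of_real ((\<Sum>n<b ^ m. f (?P n)) / real (b ^ m) - (LINT x|cube s. f x)))) \<le> ?R"
    proof (rule ennreal_norm_has_sum_le)
      fix F assume F: "finite F" "F \<subseteq> ({1..s} \<rightarrow>\<^sub>E UNIV) - {\<lambda>j\<in>{1..s}. 0 :: nat}"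
      let ?F = "{l \<in> F. deinterlace_vec b d s l \<in> ?D}"
      \<comment> \<open>Only indices whose deinterlaced vector lies in the dual lattice survive; for
        these the mean has modulus at most 1, so the coefficient bound remains.\<close>
      have "(\<Sum>l\<in>F. ennreal (norm (walsh_coeff b s f l * avg l))) =
          (\<Sum>l\<in>?F. ennreal (norm (walsh_coeff b s f l * avg l)))"
        using F(1) by (intro sum.mono_neutral_right) (auto simp: avg_0)
      also have "\<dots> \<le> (\<Sum>l\<in>?F. ennreal (\<gamma> {j \<in> {1..s}. l j \<noteq> 0} * (\<Prod>j = 1..s. r_alpha b \<alpha> (l j))))"
      proof (intro sum_mono ennreal_leI)
        fix l assume "l \<in> ?F"
        then have l: "l \<in> {1..s} \<rightarrow>\<^sub>E UNIV" "l \<noteq> (\<lambda>j\<in>{1..s}. 0)" using F(2) by auto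
        have "{j \<in> {1..s}. l j \<noteq> 0} \<noteq> {}"
          by (rule support_nonempty[OF l])
        with b have "norm (walsh_coeff b s f l) \<le> \<gamma> {j \<in> {1..s}. l j \<noteq> 0} * (\<Prod>j = 1..s. r_alpha b \<alpha> (l j))"
          by (intro walsh_coeff_bound[OF _ f assms(7) l(1)]) simp_all
        moreover have "norm (walsh_coeff b s f l * avg l) \<le> norm (walsh_coeff b s f l)"
          unfolding norm_mult by (rule mult_left_le[OF avg_le norm_ge_zero])
        ultimately show "norm (walsh_coeff b s f l * avg l) \<le>
            \<gamma> {j \<in> {1..s}. l j \<noteq> 0} * (\<Prod>j = 1..s. r_alpha b \<alpha> (l j))" by linarith
      qed
      also have "\<dots> \<le> ?R"
      proof (rule sum_over_dual_lattice_le[OF b d assms(9,7)])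
        show "finite ?F" using F(1) by simp
        show "?F \<subseteq> ({1..s} \<rightarrow>\<^sub>E UNIV) - {\<lambda>j\<in>{1..s}. 0}" using F(2) by blast
      qed simp_all
      finally show "(\<Sum>l\<in>F. ennreal (norm (walsh_coeff b s f l * avg l))) \<le> ?R" .
    qed
    then show ?thesis by (simp only: norm_of_real)
  qed
  then show ?thesis unfolding worst_case_error_def by (intro SUP_least) blast
qed

end
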